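(* The graph $K_{4,3}$ is, up to isomorphism, the only complete bipartite graph that contains a good vertex. Moreover, the vertices of the smaller block (the block with $3$ vertices) of $K_{4,3}$ are good. Hence $K_{4,3}$ is a $3/7$-Kirchhoff Šoltés graph.
   Context: All graphs are finite, simple, undirected and connected. For vertices $a,b$ of a connected graph $G$, the resistance distance $\Omega_G(a,b)$ is the effective resistance between $a$ and $b$ in the electrical network obtained from $G$ by replacing each edge by a unit resistor; equivalently $\Omega_G(a,b)=(e_a-e_b)^{T}L^{\dagger}(e_a-e_b)$, where $L$ is the Laplacian matrix of $G$, $L^{\dagger}$ its Moore–Penrose inverse, and $e_a$ the standard unit vector indexed by $a$. The Kirchhoff index of a connected graph $G$ is $Kf(G)=\sum_{\{u,v\}\subseteq V(G)}\Omega_G(u,v)$, the sum over unordered pairs of distinct vertices (so $Kf=0$ for the one-vertex graph). $G-v$ denotes the graph obtained from $G$ by deleting the vertex $v$ and its incident edges. A vertex $v$ of $G$ is good if $G-v$ is connected and $Kf(G)=Kf(G-v)$ (cut vertices are not good). $K(G)$ denotes the set of good vertices of $G$. For a rational $\beta\in(0,1]$, $G$ is a $\beta$-Kirchhoff Šoltés graph if $|K(G)|\ge\beta|V(G)|$. The complete bipartite graph $K_{m,l}$ ($m,l\geq 1$) has vertex set partitioned into two independent sets (called blocks) of sizes $m$ and $l$, with every vertex of one block adjacent to every vertex of the other. *)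

theory Defs
  imports Complex_Main "Graph_Theory.Graph_Theory"
begin

text \<open>
  Graphs are the symmetric, loop-free, finite digraphs without parallel arcs of the locale
  \<^locale>\<open>graph\<close>; each undirected edge is a pair of opposite arcs. The bare names
  graph and connected also denote constants of Main and Complex_Main, hence the qualified
  names below. The notion of connectedness used excludes the null graph.
\<close>

text \<open>
  Real square matrices with rows and columns indexed by a finite set \<open>V\<close> are functions of two
  indices; only the entries with both indices in \<open>V\<close> are meaningful.
\<close>

definition mat_mul :: "'a set \<Rightarrow> ('a \<Rightarrow> 'a \<Rightarrow> real) \<Rightarrow> ('a \<Rightarrow> 'a \<Rightarrow> real) \<Rightarrow> 'a \<Rightarrow> 'a \<Rightarrow> real" where
  "mat_mul V A B u v = (\<Sum>w\<in>V. A u w * B w v)"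

definition is_moore_penrose ::
    "'a set \<Rightarrow> ('a \<Rightarrow> 'a \<Rightarrow> real) \<Rightarrow> ('a \<Rightarrow> 'a \<Rightarrow> real) \<Rightarrow> bool" where
  "is_moore_penrose V A X \<longleftrightarrow>
     (\<forall>u\<in>V. \<forall>v\<in>V. mat_mul V (mat_mul V A X) A u v = A u v) \<and>
     (\<forall>u\<in>V. \<forall>v\<in>V. mat_mul V (mat_mul V X A) X u v = X u v) \<and>
     (\<forall>u\<in>V. \<forall>v\<in>V. mat_mul V A X u v = mat_mul V A X v u) \<and>
     (\<forall>u\<in>V. \<forall>v\<in>V. mat_mul V X A u v = mat_mul V X A v u)"

text \<open>
  The four Penrose equations determine the entries on \<open>V \<times> V\<close>; the entries outside are set to 0
  so that the description below is unique as a function.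
\<close>

definition moore_penrose :: "'a set \<Rightarrow> ('a \<Rightarrow> 'a \<Rightarrow> real) \<Rightarrow> 'a \<Rightarrow> 'a \<Rightarrow> real" where
  "moore_penrose V A =
     (THE X. is_moore_penrose V A X \<and> (\<forall>u v. u \<notin> V \<or> v \<notin> V \<longrightarrow> X u v = 0))"

definition laplacian :: "('a, 'b) pre_digraph \<Rightarrow> 'a \<Rightarrow> 'a \<Rightarrow> real" where
  "laplacian G u v =
     (if u = v then real (out_degree G u) else if u \<rightarrow>\<^bsub>G\<^esub> v then - 1 else 0)"

definition unit_vector :: "'a \<Rightarrow> 'a \<Rightarrow> real" where
  "unit_vector a u = (if u = a then 1 else 0)"

definition resistance_distance :: "('a, 'b) pre_digraph \<Rightarrow> 'a \<Rightarrow> 'a \<Rightarrow> real" where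
  "resistance_distance G a b =
     (\<Sum>u\<in>verts G. \<Sum>v\<in>verts G.
        (unit_vector a u - unit_vector b u) * moore_penrose (verts G) (laplacian G) u v *
        (unit_vector a v - unit_vector b v))"

lemma resistance_distance_sym: "resistance_distance G a b = resistance_distance G b a"
  unfolding resistance_distance_def by (intro sum.cong refl) (simp add: algebra_simps)

text \<open>
  By symmetry, the sum over unordered pairs of distinct vertices is half the sum over ordered ones.
\<close>

definition kirchhoff_index :: "('a, 'b) pre_digraph \<Rightarrow> real" where
  "kirchhoff_index G =
     (\<Sum>(u, v)\<in>{(u, v). u \<in> verts G \<and> v \<in> verts G \<and> u \<noteq> v}. resistance_distance G u v) / 2"

definition good_vertex :: "('a, 'b) pre_digraph \<Rightarrow> 'a \<Rightarrow> bool" where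
  "good_vertex G v \<longleftrightarrow>
     v \<in> verts G \<and> Digraph_Component.connected (pre_digraph.del_vert G v) \<and>
     kirchhoff_index G = kirchhoff_index (pre_digraph.del_vert G v)"

definition good_vertices :: "('a, 'b) pre_digraph \<Rightarrow> 'a set" where
  "good_vertices G = {v. good_vertex G v}"

definition kirchhoff_soltes_graph :: "rat \<Rightarrow> ('a, 'b) pre_digraph \<Rightarrow> bool" where
  "kirchhoff_soltes_graph \<beta> G \<longleftrightarrow>
     0 < \<beta> \<and> \<beta> \<le> 1 \<and> Digraph.graph G \<and> Digraph_Component.connected G \<and>
     of_nat (card (good_vertices G)) \<ge> \<beta> * of_nat (card (verts G))"

text \<open>
  The library only has a predicate for being a complete bipartite graph with blocks of given
  sizes; the following is a fixed representative.
\<close>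

definition left_block :: "nat \<Rightarrow> (nat + nat) set" where
  "left_block m = Inl ` {..<m}"

definition right_block :: "nat \<Rightarrow> (nat + nat) set" where
  "right_block l = Inr ` {..<l}"

definition complete_bipartite :: "nat \<Rightarrow> nat \<Rightarrow> (nat + nat, (nat + nat) \<times> (nat + nat)) pre_digraph" where
  "complete_bipartite m l = with_proj
     \<lparr> pverts = left_block m \<union> right_block l,
       parcs = left_block m \<times> right_block l \<union> right_block l \<times> left_block m \<rparr>"

lemma complete_bipartite_digraph_complete_bipartite:
  "complete_bipartite_digraph m l (complete_bipartite m l)"
proof -
  have "left_block m \<inter> right_block l = {}" "card (left_block m) = m" "card (right_block l) = l"
    by (auto simp: left_block_def right_block_def card_image)
  moreover have "finite (left_block m \<union> right_block l)"
    by (simp add: left_block_def right_block_def)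
  ultimately show ?thesis
    unfolding complete_bipartite_def complete_bipartite_digraph_pair_def by auto
qed

end

(*
  The pseudoinverse of the Laplacian of K_{m,l} can be written down, and gives
  Kf(K_{m,l}) = (m + l)((m - 1)/l + (l - 1)/m) + 1.  Deleting a vertex from the block of size
  l = k + 1 preserves Kf iff k(k + 1)(2k + m) = m^2(m - 1).  With m = gp, k = gq, p and q coprime,
  this becomes g D = N for D = p^3 - p q^2 - 2 q^3 and N = p^2 + p q + 2 q^2, which forces D to
  divide 4.  The left-hand side of the Thue equations D = 1, 2, 4 is the norm of p - q a in Z[a],
  where a^3 = a + 2; dividing by elements of norm 2 and 4 turns each solution into a unit of norm 1
  with one vanishing coordinate (in a suitable basis).  Such a unit of size at most 1 is a power of
  theta = 1 + a - a^2, and Skolem's method (149-adic, as theta^37 = 1 mod 149) finds the few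
  exponents for which the coordinate vanishes.
*)

theory Submission
  imports Defs "HOL-Computational_Algebra.Primes"
begin

section \<open>The cubic order \<open>\<int>[a]\<close> with \<open>a\<^sup>3 = a + 2\<close>\<close>

text \<open>The polynomial X^3 - X - 2 has one real and two complex roots, so the units of Z[a] have
  rank one and a vanishing coordinate is an equation in a single exponent n. Congruences alone
  cannot settle it, because every coordinate in question does vanish at some power of \<theta>
  (exponent 0, 1, 2 or -1). Inside each such residue class modulo 37 the 149-adic expansion decides:
  the leading term of \<theta>^(37 t) - 1 is a multiple of a fixed element \<mu>, and since the
  coordinate picked out by that term is not divisible by 149, the class holds no second zero.
  Positivity of p and q enters through the complex conjugates: their product is a sum of nonnegative
  terms and at least 1, hence the real value of the unit is at most 1. So only natural exponents of
  \<theta> occur, and the complex conjugates are present only through a real quadratic form.\<close>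

text \<open>\<open>Cubic x y z\<close> stands for \<open>x + y a + z a\<^sup>2\<close> where \<open>a\<^sup>3 = a + 2\<close>.\<close>

datatype cubic = Cubic (c0: int) (c1: int) (c2: int)

instantiation cubic :: comm_ring_1
begin

definition "0 = Cubic 0 0 0"
definition "1 = Cubic 1 0 0"
definition "u + v = Cubic (c0 u + c0 v) (c1 u + c1 v) (c2 u + c2 v)"
definition "- u = Cubic (- c0 u) (- c1 u) (- c2 u)"
definition "u - v = Cubic (c0 u - c0 v) (c1 u - c1 v) (c2 u - c2 v)"
definition "u * v = Cubic
  (c0 u * c0 v + 2 * (c1 u * c2 v + c2 u * c1 v))
  (c0 u * c1 v + c1 u * c0 v + (c1 u * c2 v + c2 u * c1 v) + 2 * c2 u * c2 v)
  (c0 u * c2 v + c1 u * c1 v + c2 u * c0 v + c2 u * c2 v)"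

instance
  by standard (auto simp: zero_cubic_def one_cubic_def plus_cubic_def uminus_cubic_def
      minus_cubic_def times_cubic_def algebra_simps)

end

lemma Cubic_simps [simp]:
  "Cubic x y z * Cubic x' y' z' = Cubic (x * x' + 2 * (y * z' + z * y'))
     (x * y' + y * x' + (y * z' + z * y') + 2 * z * z') (x * z' + y * y' + z * x' + z * z')"
  "c0 (u + v) = c0 u + c0 v" "c1 (u + v) = c1 u + c1 v" "c2 (u + v) = c2 u + c2 v"
  "c0 1 = 1" "c1 1 = 0" "c2 1 = 0"
  by (simp_all add: plus_cubic_def times_cubic_def one_cubic_def)

lemma of_nat_cubic: "of_nat n = Cubic (int n) 0 0"
  by (induction n) (simp_all add: zero_cubic_def one_cubic_def plus_cubic_def)

lemma of_int_cubic: "of_int i = Cubic i 0 0"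
  by (cases i rule: int_diff_cases) (simp add: of_nat_cubic minus_cubic_def)

lemma coeff_of_int_mult [simp]:
  "c0 (of_int i * u) = i * c0 u" "c1 (of_int i * u) = i * c1 u" "c2 (of_int i * u) = i * c2 u"
  by (cases u; simp add: of_int_cubic)+

section \<open>The unit \<theta> and its residues modulo 149\<close>

definition \<theta> :: cubic where "\<theta> = Cubic 1 1 (-1)"
definition \<eta> :: cubic where "\<eta> = Cubic 1 1 1"

lemma theta_eta: "\<theta> * \<eta> = 1"
  by (simp add: \<theta>_def \<eta>_def one_cubic_def)

definition norm_form :: "cubic \<Rightarrow> int" where
  "norm_form u = (case u of Cubic x y z \<Rightarrow> x^3 + 2*y^3 + 4*z^3 - x*y^2 + 2*x^2*z + x*z^2 - 2*y*z^2 - 6*x*y*z)"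

text \<open>Lets a unit be divided by powers of \<theta>, that is, multiplied by powers of its
  inverse \<eta>, without leaving norm 1.\<close>

lemma norm_form_mult_eta: "norm_form (u * \<eta>) = norm_form u"
  by (cases u) (simp add: norm_form_def \<eta>_def power2_eq_square power3_eq_cube algebra_simps)

definition \<mu> :: cubic where "\<mu> = Cubic 18342016712 10360878033 (-14734685089)"

text \<open>Modulo 149 the unit \<theta> has the small order 37, a divisor of 149 - 1, so a table of
  37 residues suffices for the sieve. The quotient \<mu> becomes the leading coefficient of the
  149-adic expansion.\<close>

lemma theta_pow_37: "\<theta> ^ 37 = 1 + of_int 149 * \<mu>"
  by (simp add: \<theta>_def \<mu>_def of_int_cubic one_cubic_def plus_cubic_def eval_nat_numeral)

text \<open>Each surviving residue belongs to a true zero of the coordinate: \<theta>^2 = 2 a - 3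
  has no a^2 term, and 36 stands for the exponent -1, since the last two coordinates of \<eta>
  agree.\<close>

lemma theta_powers_coeffs:
  assumes "r < 37"
  shows "c2 (\<theta> ^ r) mod 149 = 0 \<Longrightarrow> r = 0 \<or> r = 2"
    "c1 (\<theta> ^ r) mod 149 = 0 \<Longrightarrow> r = 0"
    "(c1 (\<theta> ^ r) - c2 (\<theta> ^ r)) mod 149 = 0 \<Longrightarrow> r = 0 \<or> r = 36"
    "(c0 (\<theta> ^ r) + c2 (\<theta> ^ r)) mod 149 = 0 \<Longrightarrow> r = 1"
proof -
  have *: "\<forall>r \<in> {..<37}. (c2 (\<theta> ^ r) mod 149 = 0 \<longrightarrow> r = 0 \<or> r = 2) \<and>
     (c1 (\<theta> ^ r) mod 149 = 0 \<longrightarrow> r = 0) \<and>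
     ((c1 (\<theta> ^ r) - c2 (\<theta> ^ r)) mod 149 = 0 \<longrightarrow> r = 0 \<or> r = 36) \<and>
     ((c0 (\<theta> ^ r) + c2 (\<theta> ^ r)) mod 149 = 0 \<longrightarrow> r = 1)"
    by (simp add: lessThan_nat_numeral power_numeral_even power_numeral_odd \<theta>_def)
  have "r \<in> {..<37}" using assms by simp
  from bspec[OF * this] show "c2 (\<theta> ^ r) mod 149 = 0 \<Longrightarrow> r = 0 \<or> r = 2"
    "c1 (\<theta> ^ r) mod 149 = 0 \<Longrightarrow> r = 0"
    "(c1 (\<theta> ^ r) - c2 (\<theta> ^ r)) mod 149 = 0 \<Longrightarrow> r = 0 \<or> r = 36"
    "(c0 (\<theta> ^ r) + c2 (\<theta> ^ r)) mod 149 = 0 \<Longrightarrow> r = 1"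
    by auto
qed

lemma prime_149: "prime (149 :: int)"
proof -
  have "prime (149 :: nat)" by simp
  then show ?thesis by (metis of_nat_numeral prime_nat_int_transfer)
qed

section \<open>Skolem's 149-adic expansion\<close>

lemma one_plus_power_quadratic:
  fixes x :: "'a :: comm_ring_1"
  shows "\<exists>z. (1 + x) ^ n = 1 + of_nat n * x + x^2 * z"
proof (induction n)
  case (Suc n)
  then obtain z where "(1 + x) ^ n = 1 + of_nat n * x + x^2 * z" by blast
  then have "(1 + x) ^ Suc n = 1 + of_nat (Suc n) * x + x^2 * (of_nat n + z + x * z)"
    by (simp add: algebra_simps power2_eq_square)
  then show ?case by blast
qed (auto intro: exI[of _ 0] simp: binomial_eq_0)

text \<open>The quadratic coefficient stays explicit because its divisibility by 149 for n = 149 is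
  needed when an expansion is raised to the 149th power.\<close>

lemma one_plus_power_cubic:
  fixes x :: "'a :: comm_ring_1"
  shows "\<exists>z. (1 + x) ^ n = 1 + of_nat n * x + of_nat (n choose 2) * x^2 + x^3 * z"
proof (induction n)
  case (Suc n)
  then obtain z where "(1 + x) ^ n = 1 + of_nat n * x + of_nat (n choose 2) * x^2 + x^3 * z" by blast
  moreover have "Suc n choose 2 = (n choose 2) + n"
    by (simp add: numeral_2_eq_2)
  ultimately have "(1 + x) ^ Suc n = 1 + of_nat (Suc n) * x + of_nat (Suc n choose 2) * x^2
      + x^3 * (of_nat (n choose 2) + z + x * z)"
    by (simp add: algebra_simps power2_eq_square power3_eq_cube)
  then show ?case by blast
qed (auto intro: exI[of _ 0] simp: binomial_eq_0)

text \<open>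
  Skolem's argument: for \<open>t > 0\<close> the power is congruent to \<open>1 + 149\<^sup>k s \<mu>\<close> modulo
  \<open>149\<^sup>k\<^sup>+\<^sup>1\<close>, with \<open>s\<close> invertible modulo 149.
\<close>

lemma theta_pow_expansion:
  assumes "t > 0"
  shows "\<exists>k s w. k \<ge> 1 \<and> \<not> 149 dvd s \<and>
    \<theta> ^ (37 * t) = 1 + of_int (149 ^ k) * (of_int s * \<mu> + of_int 149 * w)"
  using assms
proof (induction t rule: less_induct)
  case (less t)
  show ?case
  proof (cases "149 dvd t")
    case False
    obtain z where "(1 + of_int 149 * \<mu>) ^ t
        = 1 + of_nat t * (of_int 149 * \<mu>) + (of_int 149 * \<mu>)^2 * z"
      using one_plus_power_quadratic by blast
    then have "\<theta> ^ (37 * t) = 1 + of_int (149 ^ 1) * (of_int (int t) * \<mu> + of_int 149 * (\<mu>^2 * z))"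
      by (simp only: power_mult theta_pow_37) (simp add: algebra_simps power2_eq_square)
    moreover have "\<not> 149 dvd int t" using False by presburger
    ultimately show ?thesis by blast
  next
    case True
    \<comment> \<open>Raising to the 149th power leads from t' to t: the exponent of 149 grows by
      one and s is unchanged, hence still prime to 149.\<close>
    then obtain t' where t': "t = 149 * t'" by blast
    with less.prems have "t' < t" "t' > 0" by auto
    with less.IH obtain k s w where k: "k \<ge> 1" "\<not> 149 dvd s"
      and eq: "\<theta> ^ (37 * t') = 1 + of_int (149 ^ k) * (of_int s * \<mu> + of_int 149 * w)"
      by blast
    define v where "v = of_int s * \<mu> + of_int 149 * w"
    define q :: cubic where "q = of_int (149 ^ (k - 1))"
    have q: "of_int (149 ^ k) = of_int 149 * q" "of_int (149 ^ (k + 1)) = of_int 149 * of_int 149 * q"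
      using k by (cases k; simp add: q_def)+
    \<comment> \<open>For k = 1 the square term 149^(2k) alone only reaches 149^(k+1); the factor
      149 of the binomial coefficient makes it vanish modulo 149^(k+2).\<close>
    have choose: "(149 :: nat) choose 2 = 149 * 74"
      by (simp add: choose_two)
    obtain z where "(1 + of_int 149 * q * v) ^ 149 = 1 + of_nat 149 * (of_int 149 * q * v)
        + of_nat (149 choose 2) * (of_int 149 * q * v)^2 + (of_int 149 * q * v)^3 * z"
      using one_plus_power_cubic by blast
    also have "\<dots> = 1 + of_int 149 * of_int 149 * q *
        (v + of_int 149 * (of_int 74 * q * v^2 + q^2 * v^3 * z))"
      unfolding choose by (simp add: algebra_simps power2_eq_square power3_eq_cube)
    finally have "(1 + of_int 149 * q * v) ^ 149 = 1 + of_int 149 * of_int 149 * q *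
        (v + of_int 149 * (of_int 74 * q * v^2 + q^2 * v^3 * z))" .
    moreover have "\<theta> ^ (37 * t) = (\<theta> ^ (37 * t')) ^ 149"
      unfolding t' power_mult[symmetric] by (simp only: mult.assoc mult.commute[of t'])
    moreover define E where "E = of_int 74 * q * v^2 + q^2 * v^3 * z"
    ultimately have "\<theta> ^ (37 * t) = 1 + of_int (149 ^ (k + 1)) * (v + of_int 149 * E)"
      unfolding q by (simp only: eq q v_def)
    moreover have "v + of_int 149 * E = of_int s * \<mu> + of_int 149 * (w + E)"
      by (simp only: v_def distrib_left add.assoc)
    ultimately have "\<theta> ^ (37 * t) =
        1 + of_int (149 ^ (k + 1)) * (of_int s * \<mu> + of_int 149 * (w + E))"
      by (simp only:)
    then show ?thesis using k by (metis le_add2)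
  qed
qed

text \<open>Abstracts the linear coordinates that vanish on the units to be found: \<open>c2\<close>
  for D = 1, \<open>c1\<close> and \<open>c1 - c2\<close> for D = 2 with p even or odd, and
  \<open>c0 + c2\<close> for D = 4.\<close>

locale cubic_functional =
  fixes f :: "cubic \<Rightarrow> int"
  assumes add: "f (u + v) = f u + f v"
    and scale: "f (of_int i * u) = i * f u"
begin

text \<open>As \<open>f u = 0\<close>, the value is 149^k times an integer congruent to
  \<open>s * f (\<mu> * u)\<close> modulo 149, and neither factor is divisible by the prime
  149.\<close>

lemma theta_pow_37_mult_nonzero:
  assumes "t > 0" "f u = 0" "\<not> 149 dvd f (\<mu> * u)"
  shows "f (\<theta> ^ (37 * t) * u) \<noteq> 0"
proof
  assume 0: "f (\<theta> ^ (37 * t) * u) = 0"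
  obtain k s w where s: "\<not> 149 dvd s"
    and eq: "\<theta> ^ (37 * t) = 1 + of_int (149 ^ k) * (of_int s * \<mu> + of_int 149 * w)"
    using theta_pow_expansion[OF assms(1)] by blast
  have "\<theta> ^ (37 * t) * u = u + of_int (149 ^ k) * (of_int s * (\<mu> * u) + of_int 149 * (w * u))"
    unfolding eq by (simp add: algebra_simps)
  then have "f (\<theta> ^ (37 * t) * u) = 149 ^ k * (s * f (\<mu> * u) + 149 * f (w * u))"
    by (simp only: add scale assms(2) add_0)
  with 0 have "s * f (\<mu> * u) = 149 * (- f (w * u))" by simp
  then have "149 dvd s * f (\<mu> * u)" by (metis dvd_triv_left)
  moreover have "prime (149 :: int)" by (rule prime_149)
  ultimately show False
    using s assms(3) prime_dvd_multD by blast
qed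

lemma theta_pow_mod:
  "f (\<theta> ^ n) mod 149 = f (\<theta> ^ (n mod 37)) mod 149"
proof -
  obtain z where "(1 + of_int 149 * \<mu>) ^ (n div 37)
      = 1 + of_nat (n div 37) * (of_int 149 * \<mu>) + (of_int 149 * \<mu>)^2 * z"
    using one_plus_power_quadratic by blast
  then have "\<theta> ^ (37 * (n div 37)) * \<theta> ^ (n mod 37) = \<theta> ^ (n mod 37) + of_int 149 *
     ((of_nat (n div 37) * \<mu> + of_int 149 * \<mu>^2 * z) * \<theta> ^ (n mod 37))"
    by (simp only: power_mult theta_pow_37) (simp add: algebra_simps power2_eq_square)
  then have "f (\<theta> ^ (37 * (n div 37)) * \<theta> ^ (n mod 37)) mod 149 = f (\<theta> ^ (n mod 37)) mod 149"
    by (simp only: add scale) simp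
  then show ?thesis
    by (simp flip: power_add)
qed

text \<open>Uniqueness inside a residue class modulo 37: the nonvanishing result is applied at the
  known zero \<open>\<theta> ^ r\<close>.\<close>

lemma theta_pow_eq_small:
  assumes "f (\<theta> ^ n) = 0" "n mod 37 = r" "f (\<theta> ^ r) = 0" "\<not> 149 dvd f (\<mu> * \<theta> ^ r)"
  shows "n = r"
proof (rule ccontr)
  assume "n \<noteq> r"
  then have "n div 37 > 0"
    using assms(2) by (metis div_mult_mod_eq add_0 mult_zero_left gr0I)
  then have "f (\<theta> ^ (37 * (n div 37)) * \<theta> ^ r) \<noteq> 0"
    using theta_pow_37_mult_nonzero assms by blast
  then show False
    using assms(1,2) by (metis mult_div_mod_eq power_add)
qed

end

section \<open>Exponents at which a coordinate vanishes\<close>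

interpretation C1: cubic_functional c1
  by unfold_locales simp_all

interpretation C2: cubic_functional c2
  by unfold_locales simp_all

interpretation C12: cubic_functional "\<lambda>u. c1 u - c2 u"
  by unfold_locales (simp_all add: right_diff_distrib)

interpretation C02: cubic_functional "\<lambda>u. c0 u + c2 u"
  by unfold_locales (simp_all add: distrib_left)

lemma theta_pow_c2_eq_0:
  assumes "c2 (\<theta> ^ n) = 0"
  shows "n = 0 \<or> n = 2"
proof -
  have "c2 (\<theta> ^ (n mod 37)) mod 149 = 0"
    using C2.theta_pow_mod[of n] assms by simp
  then have "n mod 37 = 0 \<or> n mod 37 = 2"
    using theta_powers_coeffs(1)[of "n mod 37"] by auto
  then show ?thesis
  proof
    assume "n mod 37 = 0"
    moreover have "c2 (\<theta> ^ 0) = 0" "\<not> 149 dvd c2 (\<mu> * \<theta> ^ 0)"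
      by (simp_all add: \<mu>_def)
    ultimately show ?thesis
      by (intro disjI1 C2.theta_pow_eq_small[OF assms])
  next
    assume "n mod 37 = 2"
    moreover have "c2 (\<theta> ^ 2) = 0" "\<not> 149 dvd c2 (\<mu> * \<theta> ^ 2)"
      by (simp_all add: \<mu>_def \<theta>_def power2_eq_square)
    ultimately show ?thesis
      by (intro disjI2 C2.theta_pow_eq_small[OF assms])
  qed
qed

lemma theta_pow_c1_eq_0:
  assumes "c1 (\<theta> ^ n) = 0"
  shows "n = 0"
proof -
  have "c1 (\<theta> ^ (n mod 37)) mod 149 = 0"
    using C1.theta_pow_mod[of n] assms by simp
  then have "n mod 37 = 0"
    using theta_powers_coeffs(2)[of "n mod 37"] by auto
  moreover have "c1 (\<theta> ^ 0) = 0" "\<not> 149 dvd c1 (\<mu> * \<theta> ^ 0)"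
    by (simp_all add: \<mu>_def)
  ultimately show ?thesis
    by (intro C1.theta_pow_eq_small[OF assms])
qed

lemma theta_pow_c0_c2:
  assumes "c0 (\<theta> ^ n) + c2 (\<theta> ^ n) = 0"
  shows "n = 1"
proof -
  have "(c0 (\<theta> ^ (n mod 37)) + c2 (\<theta> ^ (n mod 37))) mod 149 = 0"
    using C02.theta_pow_mod[of n] assms by simp
  then have "n mod 37 = 1"
    using theta_powers_coeffs(4)[of "n mod 37"] by auto
  moreover have "c0 (\<theta> ^ 1) + c2 (\<theta> ^ 1) = 0"
    "\<not> 149 dvd c0 (\<mu> * \<theta> ^ 1) + c2 (\<mu> * \<theta> ^ 1)"
    by (simp_all add: \<mu>_def \<theta>_def)
  ultimately show ?thesis
    by (intro C02.theta_pow_eq_small[OF assms])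
qed

lemma theta_pow_c1_eq_c2:
  assumes "c1 (\<theta> ^ n) = c2 (\<theta> ^ n)"
  shows "n = 0"
proof (cases "n mod 37 = 36")
  case True
  \<comment> \<open>The exponent is \<open>-1\<close> modulo 37, so we expand around \<open>\<eta> = \<theta>\<^sup>-\<^sup>1\<close>.\<close>
  then have "Suc n = 37 * (n div 37 + 1)" by presburger
  then have "\<theta> ^ (37 * (n div 37 + 1)) * \<eta> = \<theta> ^ n * (\<theta> * \<eta>)"
    by (metis power_Suc2 mult.assoc)
  then have "\<theta> ^ (37 * (n div 37 + 1)) * \<eta> = \<theta> ^ n"
    by (simp add: theta_eta)
  moreover have "c1 \<eta> - c2 \<eta> = 0" "\<not> 149 dvd c1 (\<mu> * \<eta>) - c2 (\<mu> * \<eta>)"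
    by (simp_all add: \<eta>_def \<mu>_def)
  ultimately show ?thesis
    using C12.theta_pow_37_mult_nonzero[of "n div 37 + 1" \<eta>] assms by simp
next
  case False
  have "(c1 (\<theta> ^ (n mod 37)) - c2 (\<theta> ^ (n mod 37))) mod 149 = 0"
    using C12.theta_pow_mod[of n] assms by simp
  with False have "n mod 37 = 0"
    using theta_powers_coeffs(3)[of "n mod 37"] by auto
  moreover have "c1 (\<theta> ^ 0) - c2 (\<theta> ^ 0) = 0" "\<not> 149 dvd c1 (\<mu> * \<theta> ^ 0) - c2 (\<mu> * \<theta> ^ 0)"
    by (simp_all add: \<mu>_def)
  moreover have "c1 (\<theta> ^ n) - c2 (\<theta> ^ n) = 0"
    using assms by simp
  ultimately show ?thesis
    by (intro C12.theta_pow_eq_small[of n 0])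
qed

section \<open>Units of the cubic order\<close>

text \<open>The real root of X^3 - X - 2. The enclosure is part of the choice so that later
  estimates reduce to linear arithmetic in \<alpha> and its square.\<close>

definition \<alpha> :: real where
  "\<alpha> = (SOME x. 1521/1000 < x \<and> x < 1522/1000 \<and> x^3 = x + 2)"

lemma alpha: "1521/1000 < \<alpha>" "\<alpha> < 1522/1000" "\<alpha>^3 = \<alpha> + 2"
proof -
  have "\<exists>x::real. 1521/1000 \<le> x \<and> x \<le> 1522/1000 \<and> x^3 - x = 2"
    by (rule IVT') (auto intro!: continuous_intros simp: power3_eq_cube)
  then obtain x :: real where x: "1521/1000 \<le> x" "x \<le> 1522/1000" "x^3 - x = 2" by blast
  have "(1521/1000)^3 - 1521/1000 \<noteq> (2::real)" "(1522/1000)^3 - 1522/1000 \<noteq> (2::real)"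
    by (simp_all add: power3_eq_cube)
  then have "x \<noteq> 1521/1000" "x \<noteq> 1522/1000"
    using x(3) by metis+
  with x have "\<exists>x::real. 1521/1000 < x \<and> x < 1522/1000 \<and> x^3 = x + 2"
    by (intro exI[of _ x]) auto
  from someI_ex[OF this] show "1521/1000 < \<alpha>" "\<alpha> < 1522/1000" "\<alpha>^3 = \<alpha> + 2"
    unfolding \<alpha>_def by auto
qed

lemma alpha_sq: "2313/1000 < \<alpha>^2" "\<alpha>^2 < 2317/1000"
proof -
  have "(1521/1000)^2 < \<alpha>^2" "\<alpha>^2 < (1522/1000)^2"
    using alpha by (auto intro!: power_strict_mono)
  then show "2313/1000 < \<alpha>^2" "\<alpha>^2 < 2317/1000"
    by (simp_all add: power2_eq_square)
qed

lemma alpha_pow_4: "\<alpha>^4 = \<alpha>^2 + 2 * \<alpha>"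
proof -
  have "\<alpha>^4 = \<alpha> * \<alpha>^3" by (simp add: eval_nat_numeral)
  then show ?thesis by (simp add: alpha(3) algebra_simps power2_eq_square)
qed

definition val :: "cubic \<Rightarrow> real" where
  "val u = c0 u + c1 u * \<alpha> + c2 u * \<alpha>^2"

lemma val_mult: "val (u * v) = val u * val v"
proof -
  obtain x y z where u: "u = Cubic x y z" by (cases u)
  obtain x' y' z' where v: "v = Cubic x' y' z'" by (cases v)
  have "val u * val v = x * x' + (x * y' + y * x') * \<alpha> + (x * z' + y * y' + z * x') * \<alpha>^2
      + (y * z' + z * y') * \<alpha>^3 + z * z' * \<alpha>^4"
    unfolding u v val_def by (simp add: algebra_simps eval_nat_numeral)
  also have "\<dots> = val (u * v)"
    unfolding alpha(3) alpha_pow_4 u v val_def by (simp add: algebra_simps)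
  finally show ?thesis by simp
qed

lemma val_1 [simp]: "val 1 = 1"
  by (simp add: val_def)

lemma val_pow: "val (u ^ n) = val u ^ n"
  by (induction n) (simp_all add: val_mult)

text \<open>The two other conjugates of \<open>u\<close> are complex; \<open>conj_sq u\<close> is their product.\<close>

definition conj_sq :: "cubic \<Rightarrow> real" where
  "conj_sq u = (c0 u)^2 + (c1 u)^2 * (\<alpha>^2 - 1) + (c2 u)^2 * (\<alpha>^2 - 1)^2
     - c0 u * c1 u * \<alpha> + c0 u * c2 u * (2 - \<alpha>^2) - 2 * c1 u * c2 u"

lemma norm_form_eq: "norm_form u = val u * conj_sq u"
proof -
  obtain x y z where u: "u = Cubic x y z" by (cases u)
  show ?thesis
    using alpha(3) unfolding u norm_form_def val_def conj_sq_def by simp algebra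
qed

text \<open>The complex roots are -\<alpha>/2 plus or minus i times the square root of 3/4
  \<alpha>^2 - 1. So \<open>R\<close> is the real part of a complex conjugate of u, and
  \<open>B\<close> times that root its imaginary part.\<close>

lemma conj_sq_eq:
  fixes u
  defines "B \<equiv> c1 u - \<alpha> * c2 u" and "R \<equiv> c0 u - \<alpha> * c1 u / 2 + (1 - \<alpha>^2 / 2) * c2 u"
  shows "conj_sq u = R^2 + (3/4 * \<alpha>^2 - 1) * B^2"
proof -
  obtain x y z where u: "u = Cubic x y z" by (cases u)
  have "4 * conj_sq u = 4 * (R^2 + (3/4 * \<alpha>^2 - 1) * B^2)"
    using alpha(3) unfolding u conj_sq_def B_def R_def
    by (simp add: field_simps) algebra
  then show ?thesis by simp
qed

lemma conj_sq_nonneg: "conj_sq u \<ge> 0"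
  unfolding conj_sq_eq using alpha_sq by (intro add_nonneg_nonneg mult_nonneg_nonneg) auto

lemma val_pos:
  assumes "norm_form u = 1"
  shows "val u > 0"
proof -
  have "val u * conj_sq u = 1"
    using norm_form_eq[of u] assms by simp
  then show ?thesis
    using conj_sq_nonneg[of u] by (smt (verit) mult_nonpos_nonneg)
qed

lemma val_theta: "0 < val \<theta>" "val \<theta> < 1" and val_eta: "val \<eta> < 484/100"
  using alpha alpha_sq by (simp_all add: val_def \<theta>_def \<eta>_def)

text \<open>
  Both \<open>val u\<close> and \<open>conj_sq u\<close> are bounded, so \<open>u\<close> lies in a finite box.
\<close>

lemma unit_in_fundamental_domain:
  assumes "norm_form u = 1" "val \<theta> < val u" "val u \<le> 1"
  shows "u = 1"
proof -
  obtain x y z where u: "u = Cubic x y z" by (cases u)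
  define B where "B = y - \<alpha> * z"
  define R where "R = x - \<alpha> * y / 2 + (1 - \<alpha>^2 / 2) * z"
  have "conj_sq u * val u = 1"
    using norm_form_eq[of u] assms by (simp add: mult.commute)
  moreover have "val \<eta> * val \<theta> = 1"
    using val_mult[of \<eta> \<theta>] theta_eta by (simp add: mult.commute)
  moreover have "val \<eta> * val \<theta> < val \<eta> * val u"
    using assms \<open>val \<eta> * val \<theta> = 1\<close> val_theta(1)
    by (intro mult_strict_left_mono) (auto intro: zero_less_mult_pos2[of _ "val \<theta>"])
  \<comment> \<open>\<open>conj_sq u\<close> is the inverse of \<open>val u\<close>, and
    \<open>val \<eta>\<close> the inverse of \<open>val \<theta>\<close>. The numbers below come
    from 4.84 = 2.2^2 and 4.84 / 0.734 < 2.57^2.\<close>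
  ultimately have "conj_sq u < val \<eta>"
    using val_theta assms by (metis mult_less_cancel_right_pos order.strict_trans)
  then have "R^2 + (3/4 * \<alpha>^2 - 1) * B^2 < 484/100"
    using val_eta conj_sq_eq[of u] by (simp add: u B_def R_def)
  moreover have "(3/4 * \<alpha>^2 - 1) * B^2 \<ge> 734/1000 * B^2"
    using alpha_sq by (intro mult_right_mono) auto
  ultimately have *: "R^2 + 734/1000 * B^2 < 484/100" by simp
  have "R^2 < (22/10)^2"
  proof -
    have "0 \<le> 734/1000 * B^2" by simp
    with * have "R^2 < 484/100" by linarith
    then show ?thesis by (simp add: power_divide)
  qed
  then have R: "\<bar>R\<bar> < 22/10"
    using power2_less_imp_less[of "\<bar>R\<bar>" "22/10"] by simp
  have "B^2 < (257/100)^2"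
  proof -
    have "0 \<le> R^2" by simp
    with * have "B^2 < 66049/10000" by linarith
    then show ?thesis by (simp add: power_divide)
  qed
  then have B: "\<bar>B\<bar> < 257/100"
    using power2_less_imp_less[of "\<bar>B\<bar>" "257/100"] by simp
  have v: "0 < val u" using assms val_theta by simp
  have aB: "\<bar>\<alpha> * B\<bar> \<le> 1522/1000 * (257/100)"
    unfolding abs_mult using alpha B by (intro mult_mono) auto
  \<comment> \<open>The combination that eliminates x and y; the factor of z is the derivative of
    X^3 - X - 2 at \<alpha>.\<close>
  have "(3 * \<alpha>^2 - 1) * z = val u - R - 3/2 * (\<alpha> * B)"
    by (simp add: u val_def B_def R_def algebra_simps power2_eq_square)
  then have "\<bar>(3 * \<alpha>^2 - 1) * z\<bar> < 10"
    using R aB v assms(3) by linarith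
  moreover have "\<bar>(3 * \<alpha>^2 - 1) * z\<bar> \<ge> 5 * \<bar>real_of_int z\<bar>"
    unfolding abs_mult using alpha_sq by (intro mult_right_mono) auto
  ultimately have "\<bar>z\<bar> < 2" by linarith
  \<comment> \<open>\<open>B\<close> bounds y, and the half-open interval for \<open>val u\<close>
    leaves one x for each y. Among the listed triples only 1, \<theta> and \<theta>^2 have norm 1,
    and the strict lower bound on \<open>val u\<close> removes the last two.\<close>
  then consider "z = -1" | "z = 0" | "z = 1" by linarith
  then show ?thesis
  proof cases
    case 1
    note z = this
    have "real_of_int x + y * \<alpha> + -1 * \<alpha>^2 > 0" "real_of_int x + y * \<alpha> + -1 * \<alpha>^2 \<le> 1"
      using v assms(3) by (simp_all add: u val_def z)
    moreover have "-4 \<le> y" "y \<le> 1"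
      using B alpha unfolding B_def z by (simp_all; linarith)+
    then have "y = -4 \<or> y = -3 \<or> y = -2 \<or> y = -1 \<or> y = 0 \<or> y = 1"
      by linarith
    ultimately have "(x, y) \<in> {(9, -4), (7, -3), (6, -2), (4, -1), (3, 0), (1, 1)}"
      using alpha alpha_sq by (elim disjE; simp; linarith)
    then show ?thesis
      using assms(1,2) alpha alpha_sq by (auto simp: u z norm_form_def val_def \<theta>_def one_cubic_def)
  next
    case 2
    note z = this
    have "real_of_int x + y * \<alpha> + 0 * \<alpha>^2 > 0" "real_of_int x + y * \<alpha> + 0 * \<alpha>^2 \<le> 1"
      using v assms(3) by (simp_all add: u val_def z)
    moreover have "-2 \<le> y" "y \<le> 2"
      using B alpha unfolding B_def z by (simp_all; linarith)+
    then have "y = -2 \<or> y = -1 \<or> y = 0 \<or> y = 1 \<or> y = 2"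
      by linarith
    ultimately have "(x, y) \<in> {(4, -2), (2, -1), (1, 0), (-1, 1), (-3, 2)}"
      using alpha alpha_sq by (elim disjE; simp; linarith)
    then show ?thesis
      using assms(1,2) alpha alpha_sq by (auto simp: u z norm_form_def val_def \<theta>_def one_cubic_def)
  next
    case 3
    note z = this
    have "real_of_int x + y * \<alpha> + 1 * \<alpha>^2 > 0" "real_of_int x + y * \<alpha> + 1 * \<alpha>^2 \<le> 1"
      using v assms(3) by (simp_all add: u val_def z)
    moreover have "-1 \<le> y" "y \<le> 4"
      using B alpha unfolding B_def z by (simp_all; linarith)+
    then have "y = -1 \<or> y = 0 \<or> y = 1 \<or> y = 2 \<or> y = 3 \<or> y = 4"
      by linarith
    ultimately have "(x, y) \<in> {(0, -1), (-2, 0), (-3, 1), (-5, 2), (-6, 3), (-8, 4)}"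
      using alpha alpha_sq by (elim disjE; simp; linarith)
    then show ?thesis
      using assms(1,2) alpha alpha_sq by (auto simp: u z norm_form_def val_def \<theta>_def one_cubic_def)
  qed
qed

text \<open>The powers of \<open>val \<theta>\<close> decrease from 1 to 0, so \<open>val u\<close>
  lies between two consecutive ones; multiplying by a power of \<eta> moves u into the fundamental
  domain. The bound \<open>val u \<le> 1\<close> makes the exponent a natural number.\<close>

theorem unit_is_theta_pow:
  assumes "norm_form u = 1" "val u \<le> 1"
  shows "\<exists>n. u = \<theta> ^ n"
proof -
  obtain N where "val \<theta> ^ N < val u"
    using real_arch_pow_inv[OF val_pos[OF assms(1)] val_theta(2)] by blast
  define n where "n = (LEAST n. val \<theta> ^ n < val u)"
  have n: "val \<theta> ^ n < val u"
    unfolding n_def by (rule LeastI) fact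
  with assms have "n \<noteq> 0" by (intro notI) simp
  then obtain m where m: "n = Suc m" by (cases n) auto
  then have le: "val u \<le> val \<theta> ^ m"
    using not_less_Least[of m "\<lambda>n. val \<theta> ^ n < val u"] unfolding n_def by simp
  define w where "w = u * \<eta> ^ m"
  have "norm_form (v * \<eta> ^ k) = norm_form v" for v k
    by (induction k arbitrary: v) (simp_all add: norm_form_mult_eta flip: mult.assoc)
  then have 1: "norm_form w = 1" using assms by (simp add: w_def)
  have te: "\<theta> ^ m * \<eta> ^ m = 1"
    by (simp add: theta_eta flip: power_mult_distrib)
  have u: "u = w * \<theta> ^ m"
    unfolding w_def mult.assoc by (simp add: te mult.commute[of "\<eta> ^ m"])
  then have "val u = val w * val \<theta> ^ m" by (simp add: val_mult val_pow)
  then have "val \<theta> < val w" "val w \<le> 1"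
    using n le val_theta unfolding m by (simp_all add: mult_le_cancel_right)
  with 1 have "w = 1" by (rule unit_in_fundamental_domain)
  with u show ?thesis by auto
qed

section \<open>The Diophantine equation\<close>

text \<open>For the units below, \<open>val u\<close> is a difference of large terms, whereas
  \<open>conj_sq u\<close> is a sum of nonnegative ones; the norm turns a lower bound on the latter
  into an upper bound on the former.\<close>

lemma is_theta_pow_if_conj_sq_ge_1:
  assumes "norm_form u = 1" "conj_sq u \<ge> 1"
  shows "\<exists>n. u = \<theta> ^ n"
proof (rule unit_is_theta_pow)
  have "val u * conj_sq u = 1"
    using norm_form_eq[of u] assms by simp
  moreover have "val u * 1 \<le> val u * conj_sq u"
    using val_pos[OF assms(1)] assms(2) by (intro mult_left_mono) auto
  ultimately show "val u \<le> 1" by simp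
qed fact

lemma sq_ge_1_real_of_int: "x > 0 \<Longrightarrow> (real_of_int x)^2 \<ge> 1"
  by (simp add: one_le_power)

text \<open>Here p - q a is itself the unit. The candidates 1 and \<theta>^2 = 2 a - 3 would force q
  = 0 or p = -3.\<close>

lemma cubic_thue_eq_1:
  fixes p q :: int
  assumes "p > 0" "q > 0"
  shows "p^3 - p * q^2 - 2 * q^3 \<noteq> 1"
proof
  assume eq: "p^3 - p * q^2 - 2 * q^3 = 1"
  define u where "u = Cubic p (-q) 0"
  have "0 \<le> (real_of_int q)^2 * (\<alpha>^2 - 1)" "0 \<le> real_of_int p * q * \<alpha>"
    using alpha alpha_sq assms by simp_all
  then have "conj_sq u \<ge> 1"
    using sq_ge_1_real_of_int[OF assms(1)] by (simp add: conj_sq_def u_def)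
  moreover have "norm_form u = 1"
    using eq by (simp add: norm_form_def u_def)
  ultimately obtain n where n: "u = \<theta> ^ n"
    using is_theta_pow_if_conj_sq_ge_1 by blast
  then have "c2 (\<theta> ^ n) = 0" by (simp add: u_def flip: n)
  then have "n = 0 \<or> n = 2" by (rule theta_pow_c2_eq_0)
  then show False
    using n assms by (auto simp: u_def one_cubic_def \<theta>_def power2_eq_square)
qed

text \<open>Both a and a - 1 have norm 2 and divide 2. As p - q a is p modulo a and p - q modulo a -
  1, the parity of p tells which of them divides it.\<close>

lemma cubic_thue_eq_2:
  fixes p q :: int
  assumes "p > 0" "q > 0"
  shows "p^3 - p * q^2 - 2 * q^3 \<noteq> 2"
proof
  assume eq: "p^3 - p * q^2 - 2 * q^3 = 2"
  show False
  proof (cases "even p")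
    case True
    then obtain r where r: "p = 2 * r" by blast
    define u where "u = Cubic (- q - r) 0 r"
    have "2 * norm_form u = p^3 - p * q^2 - 2 * q^3"
      unfolding r u_def norm_form_def by simp algebra
    then have "norm_form u = 1" using eq by simp
    moreover have "conj_sq u \<ge> 1"
    proof -
      have "(real_of_int (q + r))^2 \<ge> 1" "0 \<le> (real_of_int r)^2 * (\<alpha>^2 - 1)^2"
        "0 \<le> real_of_int (q + r) * r * (\<alpha>^2 - 2)"
        using sq_ge_1_real_of_int[of "q + r"] assms r alpha_sq by simp_all
      moreover have "conj_sq u = (real_of_int (q + r))^2 + (real_of_int r)^2 * (\<alpha>^2 - 1)^2
          + real_of_int (q + r) * r * (\<alpha>^2 - 2)"
        by (simp add: conj_sq_def u_def) algebra
      ultimately show ?thesis by linarith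
    qed
    ultimately obtain n where n: "u = \<theta> ^ n"
      using is_theta_pow_if_conj_sq_ge_1 by blast
    then have "c1 (\<theta> ^ n) = 0" by (simp add: u_def flip: n)
    then have "n = 0" by (rule theta_pow_c1_eq_0)
    then show False
      using n assms r by (auto simp: u_def one_cubic_def)
  next
    case False
    moreover have "even (p^3 - p * q^2)"
      using eq by presburger
    ultimately have "odd q" by simp
    with False have "even (p - q)" by simp
    then obtain s where "p - q = 2 * s" by (rule evenE)
    then have s: "p = q + 2 * s" by linarith
    \<comment> \<open>For p at most q the value would be negative. The sign of s makes the mixed
      term q s in \<open>conj_sq u\<close> nonnegative.\<close>
    have "s > 0"
    proof (rule ccontr)
      assume "\<not> s > 0"
      with s have "p \<le> q" by simp
      then have "p^2 \<le> q^2" using assms by (intro power_mono) simp_all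
      then have "p * p^2 \<le> p * q^2" using assms by (intro mult_left_mono) simp_all
      moreover have "p^3 = p * p^2" by algebra
      moreover have "0 < q^3" using assms by simp
      ultimately show False using eq by linarith
    qed
    define u where "u = Cubic (- q) s s"
    have "2 * norm_form u = p^3 - p * q^2 - 2 * q^3"
      unfolding s u_def norm_form_def by simp algebra
    then have "norm_form u = 1" using eq by simp
    moreover have "conj_sq u \<ge> 1"
    proof -
      \<comment> \<open>Since \<alpha>^2 - 1 exceeds 1, the negative contribution -2 s^2 of the two
        equal coordinates is absorbed.\<close>
      have "1 * 1 \<le> (\<alpha>^2 - 1) * (\<alpha>^2 - 1)"
        using alpha_sq by (intro mult_mono) auto
      then have "0 \<le> (\<alpha>^2 - 1) + (\<alpha>^2 - 1)^2 - 2"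
        using alpha_sq by (simp add: power2_eq_square)
      then have "0 \<le> (real_of_int s)^2 * ((\<alpha>^2 - 1) + (\<alpha>^2 - 1)^2 - 2)" by simp
      moreover have "(real_of_int q)^2 \<ge> 1" "0 \<le> real_of_int q * s * (\<alpha> + (\<alpha>^2 - 2))"
        using sq_ge_1_real_of_int[of q] assms \<open>s > 0\<close> alpha alpha_sq by simp_all
      moreover have "conj_sq u = (real_of_int q)^2 + (real_of_int s)^2 * ((\<alpha>^2 - 1) + (\<alpha>^2 - 1)^2 - 2)
          + real_of_int q * s * (\<alpha> + (\<alpha>^2 - 2))"
        by (simp add: conj_sq_def u_def) algebra
      ultimately show ?thesis by linarith
    qed
    ultimately obtain n where n: "u = \<theta> ^ n"
      using is_theta_pow_if_conj_sq_ge_1 by blast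
    then have "c1 (\<theta> ^ n) = c2 (\<theta> ^ n)" by (simp add: u_def flip: n)
    then have "n = 0" by (rule theta_pow_c1_eq_c2)
    then show False
      using n \<open>s > 0\<close> by (auto simp: u_def one_cubic_def)
  qed
qed

text \<open>Odd p and q would give the value 2 modulo 4; the remaining parities make (p - q a) / a^2
  integral. The unit that survives is \<theta> = (2 - a) / a^2, which is where K_{4,3} comes
  from.\<close>

lemma cubic_thue_eq_4:
  fixes p q :: int
  assumes "p > 0" "q > 0" "coprime p q" and eq: "p^3 - p * q^2 - 2 * q^3 = 4"
  shows "p = 2 \<and> q = 1"
proof -
  have "even (p^3 - p * q^2)"
    using eq by presburger
  then have "even p \<or> odd p \<and> odd q" by auto
  moreover have "\<not> (odd p \<and> odd q)"
  proof
    assume "odd p \<and> odd q"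
    then obtain x y where "p = 2 * x + 1" "q = 2 * y + 1"
      by (meson oddE)
    then have "p^3 - p * q^2 - 2 * q^3 = 4 * ((2 * x + 1) * (x^2 + x - y^2 - y)
        - (4 * y^3 + 6 * y^2 + 3 * y)) - 2"
      by (simp add: power2_eq_square power3_eq_cube algebra_simps)
    with eq show False by presburger
  qed
  ultimately have "even p" by blast
  then obtain r where r: "p = 2 * r" by blast
  have "odd q" using \<open>even p\<close> coprime_common_divisor[OF assms(3), of 2] by auto
  have "4 * r^3 - r * q^2 - q^3 = 2"
    using eq unfolding r by (simp add: power3_eq_cube)
  then have "r * q^2 + q^3 = 2 * (2 * r^3 - 1)" by simp
  then have "even (r * q^2 + q^3)" by (metis dvd_triv_left)
  then have "even (q + r)" using \<open>odd q\<close> by auto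
  then obtain s where "q + r = 2 * s" by blast
  then have s: "q = 2 * s - r" by simp
  have pos: "r > 0" "s > 0" using assms r s by simp_all
  \<comment> \<open>\<open>u = (p - q a) / a\<^sup>2\<close>; in \<open>cubic_thue_eq_2\<close> the divisors are \<open>a\<close> and \<open>a - 1\<close>.\<close>
  define u where "u = Cubic s r (- s)"
  have "4 * norm_form u = p^3 - p * q^2 - 2 * q^3"
    unfolding r s u_def norm_form_def by simp algebra
  then have "norm_form u = 1" using eq by simp
  moreover have "conj_sq u \<ge> 1"
  proof -
    have "(real_of_int s)^2 \<ge> 1" "0 \<le> (real_of_int r)^2 * (\<alpha>^2 - 1)"
      "0 \<le> (real_of_int s)^2 * (\<alpha>^2 - 1)^2" "0 \<le> real_of_int s * r * (2 - \<alpha>)"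
      "0 \<le> (real_of_int s)^2 * (\<alpha>^2 - 2)"
      using sq_ge_1_real_of_int[of s] pos alpha alpha_sq by simp_all
    moreover have "conj_sq u = (real_of_int s)^2 + (real_of_int r)^2 * (\<alpha>^2 - 1)
       + (real_of_int s)^2 * (\<alpha>^2 - 1)^2 + real_of_int s * r * (2 - \<alpha>)
       + (real_of_int s)^2 * (\<alpha>^2 - 2)"
      by (simp add: conj_sq_def u_def) algebra
    ultimately show ?thesis by linarith
  qed
  ultimately obtain n where n: "u = \<theta> ^ n"
    using is_theta_pow_if_conj_sq_ge_1 by blast
  then have "c0 (\<theta> ^ n) + c2 (\<theta> ^ n) = 0" by (simp add: u_def flip: n)
  then have "n = 1" by (rule theta_pow_c0_c2)
  then show ?thesis
    using n r s by (simp add: u_def \<theta>_def)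
qed

text \<open>The part of degree 3 in p, q carries one more factor g than the part of degree 2, whence
  g D = N. Modulo D this gives 2 p q^2 = 0. As D is p^3 modulo q, it is coprime to q, so D divides 2
  p, then 4 q^3, then 4.\<close>

theorem vertex_deletion_equation:
  fixes m k :: int
  assumes "m > 0" "k > 0" and eq: "k * (k + 1) * (2 * k + m) = m^2 * (m - 1)"
  shows "m = 4 \<and> k = 2"
proof -
  define g where "g = gcd m k"
  have "g > 0" using assms by (simp add: g_def)
  obtain p q where pq: "m = g * p" "k = g * q" "coprime p q"
    using gcd_coprime_exists[of m k] assms unfolding g_def
    by (metis gcd_eq_0_iff less_irrefl mult.commute)
  have pos: "p > 0" "q > 0"
    using assms pq \<open>g > 0\<close> by (simp_all add: zero_less_mult_iff)
  define D where "D = p^3 - p * q^2 - 2 * q^3"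
  define N where "N = p^2 + p * q + 2 * q^2"
  have "g^2 * (g * D) = g^2 * N"
    using eq unfolding D_def N_def pq(1,2) by algebra
  then have gD: "g * D = N" using \<open>g > 0\<close> by simp
  have "N > 0" using pos by (simp add: N_def add_pos_pos)
  then have "D > 0" using gD \<open>g > 0\<close> by (metis zero_less_mult_pos)
  have "coprime D q"
  proof (rule coprimeI)
    fix c assume c: "c dvd D" "c dvd q"
    then have "c dvd D + q * (p * q + 2 * q^2)" by simp
    also have "D + q * (p * q + 2 * q^2) = p^3"
      unfolding D_def by algebra
    finally show "is_unit c"
      using c(2) pq(3) by (meson coprime_common_divisor coprime_power_left_iff)
  qed
  have "D dvd (p - q) * N - D" using gD by (metis dvd_diff dvd_mult dvd_refl dvd_triv_right)
  also have "(p - q) * N - D = 2 * p * q^2"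
    unfolding D_def N_def by algebra
  finally have "D dvd 2 * p"
    using \<open>coprime D q\<close> by (simp add: coprime_dvd_mult_left_iff)
  then have "D dvd 2 * p * (p^2 - q^2) - 2 * D" by (metis dvd_diff dvd_mult2 dvd_triv_right)
  also have "2 * p * (p^2 - q^2) - 2 * D = 4 * q^3"
    unfolding D_def by algebra
  finally have "D dvd 4"
    using \<open>coprime D q\<close> by (simp add: coprime_dvd_mult_left_iff)
  then have "D \<le> 4" by (simp add: zdvd_imp_le)
  with \<open>D > 0\<close> have "D = 1 \<or> D = 2 \<or> D = 3 \<or> D = 4" by linarith
  with \<open>D dvd 4\<close> have "D = 1 \<or> D = 2 \<or> D = 4" by auto
  then have "D = 4"
    using cubic_thue_eq_1[OF pos] cubic_thue_eq_2[OF pos] unfolding D_def by blast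
  then have "p = 2" "q = 1"
    using cubic_thue_eq_4[OF pos pq(3)] unfolding D_def by blast+
  moreover from this have "g = 2" using gD \<open>D = 4\<close> by (simp add: N_def)
  ultimately show ?thesis using pq by simp
qed

section \<open>Moore-Penrose inverses and the Kirchhoff index\<close>

lemma mat_mul_cong:
  assumes "\<And>w. w \<in> V \<Longrightarrow> A u w = A' u w" "\<And>w. w \<in> V \<Longrightarrow> B w v = B' w v"
  shows "mat_mul V A B u v = mat_mul V A' B' u v"
  unfolding mat_mul_def using assms by simp

lemma mat_mul_assoc:
  "mat_mul V (mat_mul V A B) C u v = mat_mul V A (mat_mul V B C) u v"
proof -
  have "(\<Sum>w\<in>V. \<Sum>x\<in>V. A u x * B x w * C w v) = (\<Sum>x\<in>V. \<Sum>w\<in>V. A u x * B x w * C w v)"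
    by (rule sum.swap)
  then show ?thesis
    by (simp add: mat_mul_def sum_distrib_left sum_distrib_right mult.assoc)
qed

lemma mat_mul_transpose:
  "mat_mul V A B u v = mat_mul V (\<lambda>x y. B y x) (\<lambda>x y. A y x) v u"
  by (simp add: mat_mul_def mult.commute)

text \<open>Penrose's argument: AX = (AY)(AX), and taking transposes of these symmetric products
  gives AX = AY. Likewise XA = YA, so X = XAX = YAX = YAY = Y.\<close>

lemma moore_penrose_unique:
  assumes X: "is_moore_penrose V A X" and Y: "is_moore_penrose V A Y"
    and uv: "u \<in> V" "v \<in> V"
  shows "X u v = Y u v"
proof -
  have AX: "mat_mul V A X u v = mat_mul V A Y u v" if uv: "u \<in> V" "v \<in> V" for u v
  proof -
    have "mat_mul V A X u v = mat_mul V (mat_mul V (mat_mul V A Y) A) X u v"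
      using Y uv by (intro mat_mul_cong) (simp_all add: is_moore_penrose_def)
    also have "\<dots> = mat_mul V (mat_mul V A Y) (mat_mul V A X) u v"
      by (rule mat_mul_assoc)
    also have "\<dots> = mat_mul V (\<lambda>x y. mat_mul V A X y x) (\<lambda>x y. mat_mul V A Y y x) v u"
      by (rule mat_mul_transpose)
    also have "\<dots> = mat_mul V (mat_mul V A X) (mat_mul V A Y) v u"
      using X Y uv by (intro mat_mul_cong) (simp_all add: is_moore_penrose_def)
    also have "\<dots> = mat_mul V (mat_mul V (mat_mul V A X) A) Y v u"
      by (rule mat_mul_assoc[symmetric])
    also have "\<dots> = mat_mul V A Y v u"
      using X uv by (intro mat_mul_cong) (simp_all add: is_moore_penrose_def)
    also have "\<dots> = mat_mul V A Y u v"
      using Y uv by (simp add: is_moore_penrose_def)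
    finally show ?thesis .
  qed
  have XA: "mat_mul V X A u v = mat_mul V Y A u v" if uv: "u \<in> V" "v \<in> V" for u v
  proof -
    have "mat_mul V X A u v = mat_mul V X (mat_mul V (mat_mul V A Y) A) u v"
      using Y uv by (intro mat_mul_cong) (simp_all add: is_moore_penrose_def)
    also have "\<dots> = mat_mul V X (mat_mul V A (mat_mul V Y A)) u v"
      by (intro mat_mul_cong mat_mul_assoc refl)
    also have "\<dots> = mat_mul V (mat_mul V X A) (mat_mul V Y A) u v"
      by (rule mat_mul_assoc[symmetric])
    also have "\<dots> = mat_mul V (\<lambda>x y. mat_mul V Y A y x) (\<lambda>x y. mat_mul V X A y x) v u"
      by (rule mat_mul_transpose)
    also have "\<dots> = mat_mul V (mat_mul V Y A) (mat_mul V X A) v u"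
      using X Y uv by (intro mat_mul_cong) (simp_all add: is_moore_penrose_def)
    also have "\<dots> = mat_mul V Y (mat_mul V A (mat_mul V X A)) v u"
      by (rule mat_mul_assoc)
    also have "\<dots> = mat_mul V Y (mat_mul V (mat_mul V A X) A) v u"
      by (intro mat_mul_cong mat_mul_assoc[symmetric] refl)
    also have "\<dots> = mat_mul V Y A v u"
      using X uv by (intro mat_mul_cong) (simp_all add: is_moore_penrose_def)
    also have "\<dots> = mat_mul V Y A u v"
      using Y uv by (simp add: is_moore_penrose_def)
    finally show ?thesis .
  qed
  have "X u v = mat_mul V (mat_mul V X A) X u v"
    using X uv by (simp add: is_moore_penrose_def)
  also have "\<dots> = mat_mul V (mat_mul V Y A) X u v"
    by (rule mat_mul_cong) (simp_all add: XA uv)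
  also have "\<dots> = mat_mul V Y (mat_mul V A X) u v"
    by (rule mat_mul_assoc)
  also have "\<dots> = mat_mul V Y (mat_mul V A Y) u v"
    by (rule mat_mul_cong) (simp_all add: AX uv)
  also have "\<dots> = mat_mul V (mat_mul V Y A) Y u v"
    by (rule mat_mul_assoc[symmetric])
  also have "\<dots> = Y u v"
    using Y uv by (simp add: is_moore_penrose_def)
  finally show ?thesis .
qed

lemma is_moore_penrose_cong:
  assumes "\<And>u v. u \<in> V \<Longrightarrow> v \<in> V \<Longrightarrow> X u v = Y u v"
  shows "is_moore_penrose V A X \<longleftrightarrow> is_moore_penrose V A Y"
proof -
  have "mat_mul V A X u v = mat_mul V A Y u v" "mat_mul V X A u v = mat_mul V Y A u v"
    if "u \<in> V" "v \<in> V" for u v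
    using assms that by (auto intro!: mat_mul_cong)
  moreover from this have "mat_mul V (mat_mul V A X) A u v = mat_mul V (mat_mul V A Y) A u v"
    "mat_mul V (mat_mul V X A) X u v = mat_mul V (mat_mul V Y A) Y u v"
    if "u \<in> V" "v \<in> V" for u v
    using assms that by (auto intro!: mat_mul_cong)
  ultimately show ?thesis
    using assms by (simp add: is_moore_penrose_def)
qed

lemma moore_penrose_eqI:
  assumes "is_moore_penrose V A X" "u \<in> V" "v \<in> V"
  shows "moore_penrose V A u v = X u v"
proof -
  \<comment> \<open>Padding with 0 outside V meets the normalization in the definite
    description.\<close>
  define Y where "Y = (\<lambda>u v. if u \<in> V \<and> v \<in> V then X u v else 0)"
  have "is_moore_penrose V A X \<longleftrightarrow> is_moore_penrose V A Y"
    by (rule is_moore_penrose_cong) (simp add: Y_def)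
  with assms(1) have Y: "is_moore_penrose V A Y" by simp
  have "moore_penrose V A = Y"
    unfolding moore_penrose_def
  proof (rule the_equality)
    show "is_moore_penrose V A Y \<and> (\<forall>u v. u \<notin> V \<or> v \<notin> V \<longrightarrow> Y u v = 0)"
      using Y by (auto simp: Y_def)
  next
    fix Z assume Z: "is_moore_penrose V A Z \<and> (\<forall>u v. u \<notin> V \<or> v \<notin> V \<longrightarrow> Z u v = 0)"
    show "Z = Y"
    proof (intro ext)
      fix u v show "Z u v = Y u v"
        using moore_penrose_unique[of V A Z Y u v] Y Z by (cases "u \<in> V \<and> v \<in> V") (auto simp: Y_def)
    qed
  qed
  then show ?thesis using assms by (simp add: Y_def)
qed

section \<open>The Kirchhoff index as a trace\<close>

lemma resistance_distance_eq:
  assumes "finite (verts G)" "is_moore_penrose (verts G) (laplacian G) X"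
    and ab: "a \<in> verts G" "b \<in> verts G"
  shows "resistance_distance G a b = X a a - X a b - X b a + X b b"
proof -
  have unit: "(\<Sum>u\<in>verts G. (unit_vector a u - unit_vector b u) * f u) = f a - f b" for f
    using assms(1) ab
    by (simp add: left_diff_distrib sum_subtractf unit_vector_def if_distrib[of "\<lambda>x. x * _"] cong: if_cong)
  have "resistance_distance G a b = (\<Sum>u\<in>verts G. (unit_vector a u - unit_vector b u) *
      (\<Sum>v\<in>verts G. (unit_vector a v - unit_vector b v) * X u v))"
    unfolding resistance_distance_def sum_distrib_left
    using moore_penrose_eqI[OF assms(2)] by (intro sum.cong refl) simp
  also have "\<dots> = X a a - X a b - X b a + X b b"
    unfolding unit by simp
  finally show ?thesis .
qed

text \<open>Equal pairs contribute 0 and may be added. Over all ordered pairs each off-diagonal term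
  then sums to the total of X, which is 0, and each diagonal term to n times the trace; halving
  leaves one trace term.\<close>

lemma kirchhoff_index_eq:
  fixes G :: "('a, 'b) pre_digraph" and X :: "'a \<Rightarrow> 'a \<Rightarrow> real"
  assumes "finite (verts G)" and X: "is_moore_penrose (verts G) (laplacian G) X"
    and sum_0: "(\<Sum>u\<in>verts G. \<Sum>v\<in>verts G. X u v) = 0"
  shows "kirchhoff_index G = card (verts G) * (\<Sum>u\<in>verts G. X u u)"
proof -
  let ?V = "verts G"
  have "(\<Sum>(u, v)\<in>{(u, v). u \<in> ?V \<and> v \<in> ?V \<and> u \<noteq> v}. resistance_distance G u v)
      = (\<Sum>(u, v)\<in>?V \<times> ?V. X u u - X u v - X v u + X v v)"
    using assms(1) by (intro sum.mono_neutral_cong_left) (auto simp: resistance_distance_eq[OF assms(1) X])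
  also have "\<dots> = (\<Sum>u\<in>?V. \<Sum>v\<in>?V. X u u - X u v - X v u + X v v)"
    using assms(1) by (simp add: sum.cartesian_product)
  also have "\<dots> = (\<Sum>u\<in>?V. \<Sum>v\<in>?V. X u u) - (\<Sum>u\<in>?V. \<Sum>v\<in>?V. X u v)
     - (\<Sum>u\<in>?V. \<Sum>v\<in>?V. X v u) + (\<Sum>u\<in>?V. \<Sum>v\<in>?V. X v v)"
    by (simp add: sum.distrib sum_subtractf)
  also have "(\<Sum>u\<in>?V. \<Sum>v\<in>?V. X v u) = 0"
    using sum_0 by (subst sum.swap)
  also have "(\<Sum>u\<in>?V. \<Sum>v\<in>?V. X u u) = card ?V * (\<Sum>u\<in>?V. X u u)"
    by (simp add: sum_distrib_left)
  also have "(\<Sum>u\<in>?V. \<Sum>v\<in>?V. X v v) = card ?V * (\<Sum>u\<in>?V. X u u)"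
    by simp
  finally show ?thesis
    unfolding kirchhoff_index_def sum_0 by simp
qed

section \<open>Complete bipartite graphs\<close>

text \<open>The blocks are explicit so that a good vertex can be located in one of them, and may be
  empty so that deleting the only vertex of a block stays within the notion. Injectivity excludes
  parallel arcs, which makes \<open>out_degree\<close> count neighbours.\<close>

definition complete_bipartite_on :: "('a, 'b) pre_digraph \<Rightarrow> 'a set \<Rightarrow> 'a set \<Rightarrow> bool" where
  "complete_bipartite_on G A B \<longleftrightarrow> finite A \<and> finite B \<and> A \<inter> B = {} \<and> verts G = A \<union> B \<and>
     arcs_ends G = A \<times> B \<union> B \<times> A \<and> inj_on (arc_to_ends G) (arcs G)"

lemma complete_bipartite_on_commute:
  "complete_bipartite_on G A B \<longleftrightarrow> complete_bipartite_on G B A"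
  unfolding complete_bipartite_on_def by (simp only: Int_commute Un_commute conj_ac)

lemma complete_bipartite_on_del_vert:
  assumes "complete_bipartite_on G A B" "v \<in> B"
  shows "complete_bipartite_on (pre_digraph.del_vert G v) A (B - {v})"
proof -
  have "arcs_ends (pre_digraph.del_vert G v) = {(x, y) \<in> arcs_ends G. x \<noteq> v \<and> y \<noteq> v}"
    by (auto simp: arcs_ends_conv pre_digraph.del_vert_simps)
  then show ?thesis
    using assms unfolding complete_bipartite_on_def
    by (auto simp: pre_digraph.del_vert_simps pre_digraph.ends_del_vert inj_on_def)
qed

context
  fixes G :: "('a, 'b) pre_digraph" and A B :: "'a set"
  assumes G: "complete_bipartite_on G A B"
begin

lemma complete_bipartite_on_dominates:
  "u \<rightarrow>\<^bsub>G\<^esub> v \<longleftrightarrow> u \<in> A \<and> v \<in> B \<or> u \<in> B \<and> v \<in> A"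
proof -
  have "arcs_ends G = A \<times> B \<union> B \<times> A"
    using G unfolding complete_bipartite_on_def by blast
  then show ?thesis by simp
qed

lemma complete_bipartite_on_out_degree:
  "u \<in> A \<Longrightarrow> out_degree G u = card B" "u \<in> B \<Longrightarrow> out_degree G u = card A"
proof -
  have *: "out_degree G u = card {v. u \<rightarrow>\<^bsub>G\<^esub> v}" for u
  proof -
    have "out_arcs G u \<subseteq> arcs G" by (auto simp: out_arcs_def)
    moreover have "inj_on (arc_to_ends G) (arcs G)"
      using G by (simp add: complete_bipartite_on_def)
    ultimately have "card (arc_to_ends G ` out_arcs G u) = out_degree G u"
      unfolding out_degree_def by (intro card_image) (rule inj_on_subset)
    moreover have "arc_to_ends G ` out_arcs G u = Pair u ` {v. u \<rightarrow>\<^bsub>G\<^esub> v}"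
      by (auto simp: arcs_ends_def arc_to_ends_def out_arcs_def image_iff)
    moreover have "card (Pair u ` {v. u \<rightarrow>\<^bsub>G\<^esub> v}) = card {v. u \<rightarrow>\<^bsub>G\<^esub> v}"
      by (intro card_image) (simp add: inj_on_def)
    ultimately show ?thesis by simp
  qed
  have "A \<inter> B = {}" using G by (simp add: complete_bipartite_on_def)
  then have "{v. u \<rightarrow>\<^bsub>G\<^esub> v} = B" if "u \<in> A" for u
    using that unfolding complete_bipartite_on_dominates by blast
  then show "u \<in> A \<Longrightarrow> out_degree G u = card B" by (simp add: *)
  have "{v. u \<rightarrow>\<^bsub>G\<^esub> v} = A" if "u \<in> B" for u
    using that \<open>A \<inter> B = {}\<close> unfolding complete_bipartite_on_dominates by blast
  then show "u \<in> B \<Longrightarrow> out_degree G u = card A" by (simp add: *)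
qed

section \<open>Laplacian and pseudoinverse of a complete bipartite graph\<close>

lemma sum_verts_complete_bipartite_on:
  "(\<Sum>w\<in>verts G. f w) = (\<Sum>w\<in>A. f w) + (\<Sum>w\<in>B. f w)" for f :: "'a \<Rightarrow> real"
  using G by (simp add: complete_bipartite_on_def sum.union_disjoint)

lemma sum_laplacian_complete_bipartite_on:
  fixes f :: "'a \<Rightarrow> real"
  shows "u \<in> A \<Longrightarrow> (\<Sum>w\<in>verts G. laplacian G u w * f w) = card B * f u - (\<Sum>w\<in>B. f w)"
    "u \<in> B \<Longrightarrow> (\<Sum>w\<in>verts G. laplacian G u w * f w) = card A * f u - (\<Sum>w\<in>A. f w)"
proof -
  have fin: "finite A" "finite B" and disj: "A \<inter> B = {}"
    using G by (auto simp: complete_bipartite_on_def)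
  show "(\<Sum>w\<in>verts G. laplacian G u w * f w) = card B * f u - (\<Sum>w\<in>B. f w)" if u: "u \<in> A"
  proof -
    have "(\<Sum>w\<in>A. laplacian G u w * f w) = (\<Sum>w\<in>A. if w = u then card B * f u else 0)"
      using u disj complete_bipartite_on_out_degree complete_bipartite_on_dominates
      by (intro sum.cong refl) (auto simp: laplacian_def)
    moreover have "(\<Sum>w\<in>B. laplacian G u w * f w) = (\<Sum>w\<in>B. - f w)"
      using u disj complete_bipartite_on_dominates
      by (intro sum.cong refl) (auto simp: laplacian_def)
    ultimately show ?thesis
      using u fin by (simp add: sum_verts_complete_bipartite_on sum_negf)
  qed
  show "(\<Sum>w\<in>verts G. laplacian G u w * f w) = card A * f u - (\<Sum>w\<in>A. f w)" if u: "u \<in> B"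
  proof -
    have "(\<Sum>w\<in>B. laplacian G u w * f w) = (\<Sum>w\<in>B. if w = u then card A * f u else 0)"
      using u disj complete_bipartite_on_out_degree complete_bipartite_on_dominates
      by (intro sum.cong refl) (auto simp: laplacian_def)
    moreover have "(\<Sum>w\<in>A. laplacian G u w * f w) = (\<Sum>w\<in>A. - f w)"
      using u disj complete_bipartite_on_dominates
      by (intro sum.cong refl) (auto simp: laplacian_def)
    ultimately show ?thesis
      using u fin by (simp add: sum_verts_complete_bipartite_on sum_negf)
  qed
qed

lemma laplacian_complete_bipartite_on_sym: "laplacian G u v = laplacian G v u"
  by (auto simp: laplacian_def complete_bipartite_on_dominates)

text \<open>
  Determined by \<open>L X = X L = I - J / n\<close> and vanishing column sums, where \<open>n = m + l\<close>
  and \<open>J\<close> is the all-ones matrix.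
\<close>

definition bipartite_pinv :: "'a \<Rightarrow> 'a \<Rightarrow> real" where
  "bipartite_pinv u v = (let m = real (card A); l = real (card B); n = m + l in
     if u \<in> A \<and> v \<in> A then (if u = v then 1 / l else 0) - 1 / (m * l) + l / (m * n^2)
     else if u \<in> A \<or> v \<in> A then - 1 / n^2
     else (if u = v then 1 / m else 0) - 1 / (m * l) + m / (l * n^2))"

context
  assumes nonempty: "A \<noteq> {}" "B \<noteq> {}"
begin

text \<open>A row of the Laplacian sees a column only through one entry and the sum over the
  opposite block, hence the separate block sums. They cancel, so every column sums to 0.\<close>

lemma sum_bipartite_pinv:
  defines "m \<equiv> real (card A)" and "l \<equiv> real (card B)"
  assumes v: "v \<in> verts G"
  shows "(\<Sum>w\<in>A. bipartite_pinv w v) = (if v \<in> A then l / (m + l)^2 else - m / (m + l)^2)"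
    "(\<Sum>w\<in>B. bipartite_pinv w v) = (if v \<in> A then - l / (m + l)^2 else m / (m + l)^2)"
proof -
  have fin: "finite A" "finite B" and disj: "A \<inter> B = {}" and V: "verts G = A \<union> B"
    using G by (auto simp: complete_bipartite_on_def)
  have pos: "m > 0" "l > 0"
    using fin nonempty by (simp_all add: m_def l_def card_gt_0_iff)
  show "(\<Sum>w\<in>A. bipartite_pinv w v) = (if v \<in> A then l / (m + l)^2 else - m / (m + l)^2)"
  proof (cases "v \<in> A")
    case True
    have "(\<Sum>w\<in>A. bipartite_pinv w v)
        = (\<Sum>w\<in>A. (if w = v then 1 / l else 0) + (l / (m * (m + l)^2) - 1 / (m * l)))"
      using True by (intro sum.cong refl) (simp add: bipartite_pinv_def Let_def m_def l_def)
    also have "\<dots> = 1 / l + m * (l / (m * (m + l)^2) - 1 / (m * l))"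
      using fin True by (simp add: sum.distrib m_def)
    also have "\<dots> = l / (m + l)^2"
      using pos by (simp add: right_diff_distrib)
    finally show ?thesis using True by simp
  next
    case False
    then have "(\<Sum>w\<in>A. bipartite_pinv w v) = (\<Sum>w\<in>A. - 1 / (m + l)^2)"
      by (intro sum.cong refl) (simp add: bipartite_pinv_def Let_def m_def l_def)
    then show ?thesis using False by (simp add: m_def)
  qed
  show "(\<Sum>w\<in>B. bipartite_pinv w v) = (if v \<in> A then - l / (m + l)^2 else m / (m + l)^2)"
  proof (cases "v \<in> A")
    case True
    then have "(\<Sum>w\<in>B. bipartite_pinv w v) = (\<Sum>w\<in>B. - 1 / (m + l)^2)"
      using disj by (intro sum.cong refl) (auto simp add: bipartite_pinv_def Let_def m_def l_def)
    then show ?thesis using True by (simp add: l_def)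
  next
    case False
    have "(\<Sum>w\<in>B. bipartite_pinv w v)
        = (\<Sum>w\<in>B. (if w = v then 1 / m else 0) + (m / (l * (m + l)^2) - 1 / (m * l)))"
      using False disj by (intro sum.cong refl) (auto simp: bipartite_pinv_def Let_def m_def l_def)
    also have "\<dots> = 1 / m + l * (m / (l * (m + l)^2) - 1 / (m * l))"
      using fin False v V by (simp add: sum.distrib l_def)
    also have "\<dots> = m / (m + l)^2"
      using pos by (simp add: right_diff_distrib)
    finally show ?thesis using False by simp
  qed
qed

lemma laplacian_mul_bipartite_pinv:
  assumes u: "u \<in> verts G" and v: "v \<in> verts G"
  shows "mat_mul (verts G) (laplacian G) bipartite_pinv u v
      = (if u = v then 1 else 0) - 1 / real (card (verts G))"
proof -
  define m l where "m = real (card A)" and "l = real (card B)"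
  have fin: "finite A" "finite B" and disj: "A \<inter> B = {}" and V: "verts G = A \<union> B"
    using G by (auto simp: complete_bipartite_on_def)
  have pos: "m > 0" "l > 0"
    using fin nonempty by (simp_all add: m_def l_def card_gt_0_iff)
  have card: "real (card (verts G)) = m + l"
    using fin disj V by (simp add: card_Un_disjoint m_def l_def)
  note sums = sum_bipartite_pinv[OF v, folded m_def l_def]
  show ?thesis
  proof (cases "u \<in> A")
    case True
    then have "mat_mul (verts G) (laplacian G) bipartite_pinv u v
       = l * bipartite_pinv u v - (\<Sum>w\<in>B. bipartite_pinv w v)"
      by (simp add: mat_mul_def sum_laplacian_complete_bipartite_on l_def)
    also have "\<dots> = (if u = v then 1 else 0) - 1 / (m + l)"
    proof (cases "v \<in> A")
      case v: True
      define c where "c = - 1 / (m * l) + l / (m * (m + l)^2)"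
      have "bipartite_pinv u v = (if u = v then 1 / l else 0) + c"
        using True v by (simp add: bipartite_pinv_def Let_def c_def m_def l_def)
      moreover have "l * c + l / (m + l)^2 = - 1 / (m + l)"
        unfolding c_def using pos by (simp add: divide_simps) algebra
      ultimately show ?thesis
        using pos v by (simp add: sums distrib_left)
    next
      case v: False
      have "bipartite_pinv u v = - 1 / (m + l)^2"
        using True v by (simp add: bipartite_pinv_def Let_def m_def l_def)
      moreover have "l * (- 1 / (m + l)^2) - m / (m + l)^2 = - 1 / (m + l)"
        using pos by (simp add: divide_simps) algebra
      ultimately show ?thesis
        using True v by (auto simp add: sums)
    qed
    finally show ?thesis by (simp add: card)
  next
    case False
    with u V have "u \<in> B" by simp
    then have "mat_mul (verts G) (laplacian G) bipartite_pinv u v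
       = m * bipartite_pinv u v - (\<Sum>w\<in>A. bipartite_pinv w v)"
      by (simp add: mat_mul_def sum_laplacian_complete_bipartite_on m_def)
    also have "\<dots> = (if u = v then 1 else 0) - 1 / (m + l)"
    proof (cases "v \<in> A")
      case v: True
      have "bipartite_pinv u v = - 1 / (m + l)^2"
        using False v by (simp add: bipartite_pinv_def Let_def m_def l_def)
      moreover have "m * (- 1 / (m + l)^2) - l / (m + l)^2 = - 1 / (m + l)"
        using pos by (simp add: divide_simps) algebra
      ultimately show ?thesis
        using False v by (auto simp add: sums)
    next
      case v: False
      define c where "c = - 1 / (m * l) + m / (l * (m + l)^2)"
      have "bipartite_pinv u v = (if u = v then 1 / m else 0) + c"
        using False v by (simp add: bipartite_pinv_def Let_def c_def m_def l_def)
      moreover have "m * c + m / (m + l)^2 = - 1 / (m + l)"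
        unfolding c_def using pos by (simp add: divide_simps) algebra
      ultimately show ?thesis
        using pos v by (simp add: sums distrib_left)
    qed
    finally show ?thesis by (simp add: card)
  qed
qed

lemma bipartite_pinv_sym: "bipartite_pinv u v = bipartite_pinv v u"
  by (auto simp: bipartite_pinv_def Let_def)

text \<open>Both products equal the symmetric projection P = I - J/n, and P fixes every matrix with
  vanishing column sums, in particular the Laplacian and its candidate inverse.\<close>

lemma is_moore_penrose_bipartite_pinv:
  "is_moore_penrose (verts G) (laplacian G) bipartite_pinv"
proof -
  define P where "P u v = (if u = v then 1 else 0) - 1 / real (card (verts G))" for u v :: 'a
  have fin: "finite (verts G)" using G by (auto simp: complete_bipartite_on_def)
  have LX: "mat_mul (verts G) (laplacian G) bipartite_pinv u v = P u v"
    if "u \<in> verts G" "v \<in> verts G" for u v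
    using laplacian_mul_bipartite_pinv that by (simp add: P_def)
  have XL: "mat_mul (verts G) bipartite_pinv (laplacian G) u v = P u v"
    if "u \<in> verts G" "v \<in> verts G" for u v
  proof -
    have "mat_mul (verts G) bipartite_pinv (laplacian G) u v
        = mat_mul (verts G) (laplacian G) bipartite_pinv v u"
      by (subst mat_mul_transpose)
        (simp add: mat_mul_def laplacian_complete_bipartite_on_sym[of v] bipartite_pinv_sym[of u])
    also have "\<dots> = P u v" using LX[of v u] that by (simp add: P_def)
    finally show ?thesis .
  qed
  have P_mul: "mat_mul (verts G) P M u v = M u v"
    if "u \<in> verts G" "(\<Sum>w\<in>verts G. M w v) = 0" for M u v
  proof -
    have "mat_mul (verts G) P M u v = (\<Sum>w\<in>verts G. (if u = w then M w v else 0))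
        - (\<Sum>w\<in>verts G. M w v) / real (card (verts G))"
      unfolding mat_mul_def sum_divide_distrib sum_subtractf[symmetric]
      by (intro sum.cong refl) (simp add: P_def left_diff_distrib)
    then show ?thesis using that fin by simp
  qed
  have "(\<Sum>w\<in>verts G. laplacian G w v) = 0" if "v \<in> verts G" for v
  proof -
    have "(\<Sum>w\<in>verts G. laplacian G w v) = (\<Sum>w\<in>verts G. laplacian G v w * 1)"
      by (simp add: laplacian_complete_bipartite_on_sym[of v])
    also have "\<dots> = 0"
      using that G sum_laplacian_complete_bipartite_on[of v "\<lambda>_. 1"]
      by (auto simp: complete_bipartite_on_def)
    finally show ?thesis .
  qed
  moreover have "(\<Sum>w\<in>verts G. bipartite_pinv w v) = 0" if "v \<in> verts G" for v
    by (simp add: sum_verts_complete_bipartite_on sum_bipartite_pinv[OF that])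
  moreover have "mat_mul (verts G) (mat_mul (verts G) (laplacian G) bipartite_pinv) (laplacian G) u v
      = mat_mul (verts G) P (laplacian G) u v"
    "mat_mul (verts G) (mat_mul (verts G) bipartite_pinv (laplacian G)) bipartite_pinv u v
      = mat_mul (verts G) P bipartite_pinv u v"
    if "u \<in> verts G" "v \<in> verts G" for u v
    by (rule mat_mul_cong; simp add: LX XL that)+
  moreover have "P u v = P v u" for u v by (simp add: P_def)
  ultimately show ?thesis
    unfolding is_moore_penrose_def by (intro conjI ballI) (simp_all only: P_mul LX XL)
qed

lemma kirchhoff_index_complete_bipartite_on:
  defines "m \<equiv> real (card A)" and "l \<equiv> real (card B)"
  shows "kirchhoff_index G = (m + l) * ((m - 1) / l + (l - 1) / m) + 1"
proof -
  have fin: "finite A" "finite B" and disj: "A \<inter> B = {}" and V: "verts G = A \<union> B"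
    using G by (auto simp: complete_bipartite_on_def)
  have pos: "m > 0" "l > 0"
    using fin nonempty by (simp_all add: m_def l_def card_gt_0_iff)
  have "(\<Sum>u\<in>verts G. bipartite_pinv u v) = 0" if "v \<in> verts G" for v
    by (simp add: sum_verts_complete_bipartite_on sum_bipartite_pinv[OF that])
  then have "(\<Sum>u\<in>verts G. \<Sum>v\<in>verts G. bipartite_pinv u v) = 0"
    by (subst sum.swap) simp
  then have "kirchhoff_index G = real (card (verts G)) * (\<Sum>u\<in>verts G. bipartite_pinv u u)"
    using is_moore_penrose_bipartite_pinv fin V by (intro kirchhoff_index_eq) simp_all
  also have "real (card (verts G)) = m + l"
    using fin disj V by (simp add: card_Un_disjoint m_def l_def)
  also have "(\<Sum>u\<in>verts G. bipartite_pinv u u) = (\<Sum>u\<in>A. 1 / l - 1 / (m * l) + l / (m * (m + l)^2))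
      + (\<Sum>u\<in>B. 1 / m - 1 / (m * l) + m / (l * (m + l)^2))"
    unfolding sum_verts_complete_bipartite_on using disj
    by (intro arg_cong2[of _ _ _ _ "(+)"] sum.cong refl)
      (auto simp: bipartite_pinv_def Let_def m_def l_def)
  also have "\<dots> = m * (1 / l - 1 / (m * l) + l / (m * (m + l)^2))
      + l * (1 / m - 1 / (m * l) + m / (l * (m + l)^2))"
    by (simp add: m_def l_def)
  \<comment> \<open>The correction terms add up to 1 / (m + l), the source of the summand 1 in the
    index.\<close>
  also have "\<dots> = (m - 1) / l + (l - 1) / m + 1 / (m + l)"
  proof -
    have "m * (1 / l - 1 / (m * l) + l / (m * (m + l)^2)) = (m - 1) / l + l / (m + l)^2"
      "l * (1 / m - 1 / (m * l) + m / (l * (m + l)^2)) = (l - 1) / m + m / (m + l)^2"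
      using pos by (simp_all add: field_simps)
    moreover have "l / (m + l)^2 + m / (m + l)^2 = 1 / (m + l)"
    proof -
      have "l / (m + l)^2 + m / (m + l)^2 = (m + l) / ((m + l) * (m + l))"
        by (simp add: power2_eq_square add_divide_distrib)
      then show ?thesis using pos by simp
    qed
    ultimately show ?thesis by simp
  qed
  finally show ?thesis
    using pos by (simp add: distrib_left)
qed

end

end

section \<open>Connectedness and good vertices\<close>

lemma parcs_mk_symmetric_eq_arcs_ends:
  "parcs (mk_symmetric G) = arcs_ends G \<union> (arcs_ends G)\<inverse>"
  by (auto simp: parcs_mk_symmetric arcs_ends_conv)

lemma connected_complete_bipartite_on:
  assumes G: "complete_bipartite_on G A B" and ne: "A \<noteq> {}" "B \<noteq> {}"
  shows "Digraph_Component.connected G"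
proof -
  obtain a b where ab: "a \<in> A" "b \<in> B" using ne by blast
  have V: "verts G = A \<union> B" and "arcs_ends G = A \<times> B \<union> B \<times> A"
    using G by (simp_all add: complete_bipartite_on_def)
  then have R: "parcs (mk_symmetric G) = A \<times> B \<union> B \<times> A"
    by (auto simp: parcs_mk_symmetric_eq_arcs_ends)
  have step: "(u, v) \<in> rtrancl_on (A \<union> B) (A \<times> B \<union> B \<times> A)"
    if "(u, v) \<in> A \<times> B \<union> B \<times> A" for u v
    using that by (intro converse_rtrancl_on_into_rtrancl_on[OF _ rtrancl_on_refl]) auto
  have "(u, v) \<in> rtrancl_on (A \<union> B) (A \<times> B \<union> B \<times> A)" if uv: "u \<in> A \<union> B" "v \<in> A \<union> B" for u v
  proof -
    consider "(u, v) \<in> A \<times> B \<union> B \<times> A" | "u \<in> A" "v \<in> A" | "u \<in> B" "v \<in> B"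
      using uv by blast
    then show ?thesis
    proof cases
      case 2
      then show ?thesis using ab by (intro rtrancl_on_trans[OF step[of u b] step]) auto
    next
      case 3
      then show ?thesis using ab by (intro rtrancl_on_trans[OF step[of u a] step]) auto
    qed (rule step)
  qed
  then show ?thesis
    using ne V unfolding Digraph_Component.connected_def strongly_connected_def reachable_def
    by (simp add: R)
qed

text \<open>Covers the deletion of the centre of a star, which leaves isolated vertices.\<close>

lemma connected_no_arcs:
  assumes "Digraph_Component.connected G" "arcs_ends G = {}" "u \<in> verts G" "v \<in> verts G"
  shows "u = v"
proof -
  have "(u, v) \<in> rtrancl_on (verts G) (parcs (mk_symmetric G))"
    using assms unfolding Digraph_Component.connected_def strongly_connected_def reachable_def
    by simp
  then have "(u, v) \<in> (parcs (mk_symmetric G))\<^sup>*"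
    by (rule rtrancl_on_rtranclI)
  then show ?thesis
    using assms(2) by (simp add: parcs_mk_symmetric_eq_arcs_ends)
qed

lemma good_vertex_complete_bipartite_on:
  assumes G: "complete_bipartite_on G A B" and "A \<noteq> {}" and v: "v \<in> B"
  shows "good_vertex G v \<longleftrightarrow> card A = 4 \<and> card B = 3"
proof -
  define H where "H = pre_digraph.del_vert G v"
  have H: "complete_bipartite_on H A (B - {v})"
    unfolding H_def using G v by (rule complete_bipartite_on_del_vert)
  have fin: "finite A" "finite B" and V: "v \<in> verts G"
    using G v by (auto simp: complete_bipartite_on_def)
  have good: "good_vertex G v \<longleftrightarrow>
      Digraph_Component.connected H \<and> kirchhoff_index G = kirchhoff_index H"
    using V by (simp add: good_vertex_def H_def)
  define m where "m = card A"
  define k where "k = card (B - {v})"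
  have m: "m > 0" using fin assms by (simp add: m_def card_gt_0_iff)
  have card_B: "card B = k + 1"
    using card_Suc_Diff1[OF fin(2) v] by (simp add: k_def)
  have Kf_G: "kirchhoff_index G = (m + (k + 1)) * ((real m - 1) / (k + 1) + (real k + 1 - 1) / m) + 1"
  proof -
    have "B \<noteq> {}" using v by blast
    then show ?thesis
      using kirchhoff_index_complete_bipartite_on[OF G \<open>A \<noteq> {}\<close>] by (simp add: card_B m_def)
  qed
  show ?thesis
  proof (cases "B - {v} = {}")
    case True
    then have k: "k = 0" unfolding k_def by (simp only: card.empty)
    \<comment> \<open>The index formula needs two nonempty blocks, so a singleton block is treated
      apart. The rest is connected only for K_{1,1}, where the index drops from 1 to 0.\<close>
    have "\<not> good_vertex G v"
    proof
      assume "good_vertex G v"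
      then have conn: "Digraph_Component.connected H" and Kf: "kirchhoff_index G = kirchhoff_index H"
        by (simp_all add: good)
      have VH: "verts H = A" and "arcs_ends H = {}"
        using H True by (simp_all add: complete_bipartite_on_def)
      with conn have eq: "x = y" if "x \<in> A" "y \<in> A" for x y
        using connected_no_arcs[of H x y] that by simp
      obtain a where "A = {a}" using eq \<open>A \<noteq> {}\<close> by blast
      then have "m = 1" by (simp add: m_def)
      have "{(x, y). x \<in> verts H \<and> y \<in> verts H \<and> x \<noteq> y} = {}"
        using eq VH by blast
      then have "kirchhoff_index H = 0"
        unfolding kirchhoff_index_def by (simp only: sum.empty div_0)
      then show False using Kf Kf_G \<open>m = 1\<close> k by simp
    qed
    moreover have "card B \<noteq> 3" using card_B k by simp
    ultimately show ?thesis by simp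
  next
    case False
    then have k: "k > 0" using fin by (simp add: k_def card_gt_0_iff)
    have "Digraph_Component.connected H"
      using H \<open>A \<noteq> {}\<close> False by (rule connected_complete_bipartite_on)
    moreover have Kf_H: "kirchhoff_index H = (real m + k) * ((real m - 1) / k + (real k - 1) / m) + 1"
      using kirchhoff_index_complete_bipartite_on[OF H \<open>A \<noteq> {}\<close> False] by (simp add: k_def m_def)
    moreover have "kirchhoff_index G = kirchhoff_index H \<longleftrightarrow>
        int k * (int k + 1) * (2 * int k + int m) = int m^2 * (int m - 1)"
    proof -
      define x y where "x = real m" and "y = real k"
      have xy: "x > 0" "y > 0" using m k by (simp_all add: x_def y_def)
      \<comment> \<open>Clearing the denominators m, k and k + 1, with k the size of the block after
        deletion, produces the Diophantine equation.\<close>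
      have "x * y * (y + 1) * (kirchhoff_index G - kirchhoff_index H)
          = y * (y + 1) * (2 * y + x) - x^2 * (x - 1)"
        unfolding Kf_G Kf_H of_nat_add of_nat_1 x_def[symmetric] y_def[symmetric]
        using xy by (simp add: divide_simps) algebra
      then have "kirchhoff_index G = kirchhoff_index H \<longleftrightarrow>
          y * (y + 1) * (2 * y + x) = x^2 * (x - 1)"
        using xy by (metis add_pos_pos diff_self eq_iff_diff_eq_0 less_irrefl mult_eq_0_iff zero_less_one)
      also have "\<dots> \<longleftrightarrow> real_of_int (int k * (int k + 1) * (2 * int k + int m))
          = real_of_int (int m^2 * (int m - 1))"
        by (simp add: x_def y_def)
      finally show ?thesis by (simp only: of_int_eq_iff)
    qed
    moreover have "int k * (int k + 1) * (2 * int k + int m) = int m^2 * (int m - 1)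
        \<longleftrightarrow> m = 4 \<and> k = 2"
      using vertex_deletion_equation[of "int m" "int k"] m k by auto
    ultimately show ?thesis
      using card_B by (auto simp: good m_def)
  qed
qed

lemma ex_good_vertex_complete_bipartite_on:
  assumes G: "complete_bipartite_on G A B" and ne: "A \<noteq> {}" "B \<noteq> {}"
  shows "(\<exists>v. good_vertex G v) \<longleftrightarrow> card A = 4 \<and> card B = 3 \<or> card A = 3 \<and> card B = 4"
proof -
  have G': "complete_bipartite_on G B A" using G complete_bipartite_on_commute by blast
  have "v \<in> A \<union> B" if "good_vertex G v" for v
    using that G by (simp add: good_vertex_def complete_bipartite_on_def)
  then show ?thesis
    using good_vertex_complete_bipartite_on[OF G] good_vertex_complete_bipartite_on[OF G'] ne
    by (metis Un_iff ex_in_conv)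
qed

section \<open>Isomorphism with K_{4,3}\<close>

lemma complete_bipartite_on_complete_bipartite:
  "complete_bipartite_on (complete_bipartite m l) (left_block m) (right_block l)"
  by (auto simp: complete_bipartite_on_def complete_bipartite_def left_block_def right_block_def
      arc_to_ends_def inj_on_def)

lemma card_blocks [simp]: "card (left_block m) = m" "card (right_block l) = l"
  by (simp_all add: left_block_def right_block_def card_image)

lemma complete_bipartite_digraph_imp_on:
  assumes "complete_bipartite_digraph m l G"
  obtains A B where "complete_bipartite_on G A B" "card A = m" "card B = l"
proof -
  obtain A B where AB: "verts G = A \<union> B" "A \<inter> B = {}" "card A = m" "card B = l"
    "arcs_ends G = A \<times> B \<union> B \<times> A"
    using assms unfolding complete_bipartite_digraph_def by auto
  interpret Digraph.graph G
    using assms by (simp add: complete_bipartite_digraph_def)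
  have "finite A" "finite B"
    using finite_verts AB(1) by (metis finite_Un)+
  then have "complete_bipartite_on G A B"
    using AB inj_on_arc_to_ends by (simp add: complete_bipartite_on_def)
  then show thesis using AB that by blast
qed

lemma digraph_iso_complete_bipartite:
  assumes "wf_digraph G" and G: "complete_bipartite_on G A B"
  shows "digraph_iso G (complete_bipartite (card A) (card B))"
proof -
  have fin: "finite A" "finite B" and disj: "A \<inter> B = {}" and V: "verts G = A \<union> B"
    and ends: "arcs_ends G = A \<times> B \<union> B \<times> A" and inj: "inj_on (arc_to_ends G) (arcs G)"
    using G by (simp_all add: complete_bipartite_on_def)
  obtain fa fb where fa: "bij_betw fa A (left_block (card A))" and fb: "bij_betw fb B (right_block (card B))"
    using fin finite_same_card_bij[of A "left_block (card A)"] finite_same_card_bij[of B "right_block (card B)"]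
    by (auto simp: left_block_def right_block_def card_image)
  define f where "f x = (if x \<in> A then fa x else fb x)" for x
  have fA: "f ` A = left_block (card A)"
    using fa by (simp add: f_def bij_betw_def)
  have fB: "f ` B = right_block (card B)"
    using fb disj by (force simp: f_def bij_betw_def image_def)
  have inj_f: "inj_on f (A \<union> B)"
  proof (rule eq_card_imp_inj_on)
    have "left_block (card A) \<inter> right_block (card B) = {}"
      by (auto simp: left_block_def right_block_def)
    then show "card (f ` (A \<union> B)) = card (A \<union> B)"
      using fin disj by (simp add: image_Un fA fB card_Un_disjoint left_block_def right_block_def card_image)
  qed (use fin in simp)
  \<comment> \<open>Arcs of the representative are pairs of vertices, so an arc goes to the pair of
    images of its ends.\<close>
  define h where "h = \<lparr> iso_verts = f, iso_arcs = (\<lambda>e. (f (tail G e), f (head G e))),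
    iso_head = snd, iso_tail = fst \<rparr>"
  have "inj_on (\<lambda>e. (f (tail G e), f (head G e))) (arcs G)"
  proof (rule inj_onI)
    fix e e' assume e: "e \<in> arcs G" "e' \<in> arcs G"
      and eq: "(f (tail G e), f (head G e)) = (f (tail G e'), f (head G e'))"
    have "{tail G e, head G e, tail G e', head G e'} \<subseteq> A \<union> B"
      using e assms(1) V by (auto simp: wf_digraph_def)
    then have "arc_to_ends G e = arc_to_ends G e'"
      using eq inj_f by (simp add: arc_to_ends_def inj_on_eq_iff)
    then show "e = e'" using inj e by (simp add: inj_on_eq_iff)
  qed
  then have "pre_digraph.digraph_isomorphism G h"
    using assms(1) inj_f V by (simp add: pre_digraph.digraph_isomorphism_def h_def)
  moreover have "complete_bipartite (card A) (card B) = app_iso h G"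
  proof -
    have "(\<lambda>e. (f (tail G e), f (head G e))) ` arcs G = map_prod f f ` arcs_ends G"
      by (simp add: arcs_ends_conv image_image)
    also have "\<dots> = f ` A \<times> f ` B \<union> f ` B \<times> f ` A"
      unfolding ends by (auto simp: image_Un map_prod_surj_on)
    finally show ?thesis
      by (simp add: app_iso_def h_def complete_bipartite_def with_proj_def V image_Un fA fB)
  qed
  ultimately show ?thesis unfolding digraph_iso_def by blast
qed

lemma card_arcs_complete_bipartite_on:
  assumes "complete_bipartite_on G A B"
  shows "card (verts G) = card A + card B" "card (arcs G) = 2 * card A * card B"
proof -
  have G: "finite A" "finite B" "A \<inter> B = {}" "verts G = A \<union> B" "arcs_ends G = A \<times> B \<union> B \<times> A"
    "inj_on (arc_to_ends G) (arcs G)"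
    using assms by (simp_all add: complete_bipartite_on_def)
  show "card (verts G) = card A + card B" using G by (simp add: card_Un_disjoint)
  have "card (arcs G) = card (arcs_ends G)"
    unfolding arcs_ends_def using G by (simp add: card_image)
  also have "\<dots> = card (A \<times> B) + card (B \<times> A)"
    unfolding G(5) using G by (intro card_Un_disjoint) auto
  also have "\<dots> = 2 * card A * card B"
    by (simp add: card_cartesian_product)
  finally show "card (arcs G) = 2 * card A * card B" .
qed

lemma digraph_iso_cards:
  assumes "digraph_iso G H"
  shows "card (verts H) = card (verts G)" "card (arcs H) = card (arcs G)"
  using assms by (auto simp: digraph_iso_def pre_digraph.digraph_isomorphism_def card_image)

text \<open>Isomorphism preserves the 7 vertices and the 24 arcs (two for each edge); sum 7 and
  product 12 determine the block sizes up to order.\<close>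

lemma digraph_iso_complete_bipartite_4_3_iff:
  assumes "wf_digraph G" and G: "complete_bipartite_on G A B"
  shows "digraph_iso G (complete_bipartite 4 3) \<longleftrightarrow>
    card A = 4 \<and> card B = 3 \<or> card A = 3 \<and> card B = 4"
proof
  assume "digraph_iso G (complete_bipartite 4 3)"
  from digraph_iso_cards[OF this] have "card A + card B = 7" "2 * card A * card B = 24"
    by (simp_all add: card_arcs_complete_bipartite_on[OF G]
        card_arcs_complete_bipartite_on[OF complete_bipartite_on_complete_bipartite])
  then have "card B = 7 - card A" "card A \<le> 7" "card A * card B = 12" by simp_all
  moreover from this have "card A \<in> {0,1,2,3,4,5,6,7}" by auto
  ultimately show "card A = 4 \<and> card B = 3 \<or> card A = 3 \<and> card B = 4" by auto
next
  have G': "complete_bipartite_on G B A" using G complete_bipartite_on_commute by blast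
  assume "card A = 4 \<and> card B = 3 \<or> card A = 3 \<and> card B = 4"
  then show "digraph_iso G (complete_bipartite 4 3)"
    using digraph_iso_complete_bipartite[OF assms(1) G] digraph_iso_complete_bipartite[OF assms(1) G']
    by auto
qed

theorem proposition7:
  shows "(\<forall>m l. \<forall>G :: ('a, 'b) pre_digraph.
            1 \<le> m \<and> 1 \<le> l \<and> complete_bipartite_digraph m l G \<longrightarrow>
            ((\<exists>v. good_vertex G v) \<longleftrightarrow> digraph_iso G (complete_bipartite 4 3)))
       \<and> (\<forall>v \<in> right_block 3. good_vertex (complete_bipartite 4 3) v)
       \<and> kirchhoff_soltes_graph (3 / 7) (complete_bipartite 4 3)"
proof (intro conjI allI impI ballI)
  fix m l and G :: "('a, 'b) pre_digraph"
  assume *: "1 \<le> m \<and> 1 \<le> l \<and> complete_bipartite_digraph m l G"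
  then obtain A B where G: "complete_bipartite_on G A B" and card: "card A = m" "card B = l"
    using complete_bipartite_digraph_imp_on by blast
  have "A \<noteq> {}" "B \<noteq> {}" using * card by auto
  moreover have "wf_digraph G"
  proof -
    interpret Digraph.graph G using * by (simp add: complete_bipartite_digraph_def)
    show ?thesis by (rule wf_digraph)
  qed
  ultimately show "(\<exists>v. good_vertex G v) \<longleftrightarrow> digraph_iso G (complete_bipartite 4 3)"
    using G by (simp add: ex_good_vertex_complete_bipartite_on digraph_iso_complete_bipartite_4_3_iff)
next
  fix v assume "v \<in> right_block 3"
  then show "good_vertex (complete_bipartite 4 3) v"
    using good_vertex_complete_bipartite_on[OF complete_bipartite_on_complete_bipartite[of 4 3]]
    by (metis card.empty card_blocks zero_neq_numeral)
next
  note K = complete_bipartite_on_complete_bipartite[of 4 3]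
  have ne: "left_block 4 \<noteq> {}" "right_block 3 \<noteq> {}"
    by (metis card.empty card_blocks zero_neq_numeral)+
  have card_verts: "card (verts (complete_bipartite 4 3)) = 7"
    by (simp add: card_arcs_complete_bipartite_on[OF K])
  then have "finite (verts (complete_bipartite 4 3))" by (rule_tac card_ge_0_finite) simp
  then have "finite (good_vertices (complete_bipartite 4 3))"
    by (rule rev_finite_subset) (auto simp: good_vertices_def good_vertex_def)
  \<comment> \<open>An inclusion is enough, as the Soltes condition is a lower bound, here 3 out of
    7.\<close>
  moreover have "right_block 3 \<subseteq> good_vertices (complete_bipartite 4 3)"
    using good_vertex_complete_bipartite_on[OF K ne(1)] by (auto simp: good_vertices_def)
  ultimately have "3 \<le> card (good_vertices (complete_bipartite 4 3))"
    by (metis card_mono card_blocks(2))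
  then have "(3 :: rat) \<le> of_nat (card (good_vertices (complete_bipartite 4 3)))"
    by (metis of_nat_le_iff of_nat_numeral)
  then show "kirchhoff_soltes_graph (3 / 7) (complete_bipartite 4 3)"
    using complete_bipartite_digraph_complete_bipartite[of 4 3] connected_complete_bipartite_on[OF K ne]
    by (simp add: kirchhoff_soltes_graph_def complete_bipartite_digraph_def card_verts)
qed

end
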